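(* Let $G$ be a finite abelian group with exponent $n_1=2^mp_1^{m_1}\cdots p_r^{m_r}$ ($p_1,\ldots,p_r$ distinct odd primes), and let $\mathcal{A}$ be its group scheme. Let $$\Delta=2^{w_0}(-1)^w\big((-1)^{(p_1-1)/2}p_1\big)^{w_1}\cdots\big((-1)^{(p_r-1)/2}p_r\big)^{w_r}$$ with $w,w_0,\ldots,w_r\in\{0,1\}$, $w_0=0$ if $m<3$ and $w=0$ if $m<2$. Let $$H_\Delta=\Big\{k\in\mathbb{Z}_{n_1}^*:\ \chi(k)^{w_0}\Big(\tfrac k4\Big)^{w}\Big(\tfrac k{p_1}\Big)^{w_1}\cdots\Big(\tfrac k{p_r}\Big)^{w_r}=1\Big\},$$ a subgroup of $\mathbb{Z}_{n_1}^*$, and define $g\sim_\Delta h$ iff $g=kh$ for some $k\in H_\Delta$. Let $C_1,C_2\subseteq G$ be disjoint with $0\notin C_1\cup C_2$, and $M=A_{C_1}-A_{C_2}$. Then: (i) all eigenvalues of $M$ lie in $\mathbb{Q}(\sqrt\Delta)$ if and only if both $C_1$ and $C_2$ are unions of equivalence classes of $\sim_\Delta$; (ii) all eigenvalues of $M$ are integer multiples of $\sqrt\Delta$ if and only if either $\Delta=1$ and $C_1,C_2$ are unions of equivalence classes of $\sim_1$, or $\Delta\ne1$, $C_1$ is a union of equivalence classes of $\sim_\Delta$, and $C_2=kC_1$ for some $k\in\mathbb{Z}_{n_1}^*\setminus H_\Delta$. Moreover, when $\Delta\neq1$ and the conditions in (ii) hold: if $\Delta<0$ then $C_2=-C_1$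 and $M=A_{C_1}-A_{C_1}^T$ is the skew-symmetric adjacency matrix of the oriented Cayley graph $X(G,C_1)$; if $\Delta>0$ then $C_1=-C_1$, $C_2=-C_2$ and $M$ is the symmetric adjacency matrix of the signed Cayley graph $X(G,C_1,C_2)$.
   Context: For a finite abelian group $(G,+)$, $A_g$ is the $(0,1)$-matrix indexed by $G$ with $(A_g)_{u,v}=1$ iff $v-u=g$; the group scheme is $\{A_g:g\in G\}$, and for $C\subseteq G$, $A_C=\sum_{g\in C}A_g$. The exponent $n_1$ is the least positive integer with $n_1g=0$ for all $g\in G$; for $k\in\mathbb{Z}_{n_1}^*$, $kg$ is well defined and $kC=\{kc:c\in C\}$. $\left(\frac kp\right)$ is the Legendre symbol; for odd $k$, $\left(\frac k4\right)=1$ if $k\equiv1\pmod 4$ and $-1$ if $k\equiv3\pmod4$; $\chi(k)=1$ if $k\equiv\pm1\pmod8$ and $\chi(k)=-1$ if $k\equiv\pm3\pmod8$ (these are well defined on $\mathbb{Z}_{n_1}^*$ whenever the corresponding exponent $w_0,w,w_k$ is allowed to be $1$). An oriented Cayley graph $X(G,C)$ with $C\cap(-C)=\emptyset$ has skew-symmetric adjacency matrix $A_C-A_C^T$; a signed Cayley graph $X(G,C(1),C(-1))$ with $C(\pm1)=-C(\pm1)$ disjoint has symmetric adjacency matrix $A_{C(1)}-A_{C(-1)}$. *)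

theory Defs
  imports "HOL-Analysis.Analysis" "HOL-Number_Theory.Number_Theory"
begin

definition gmul :: "nat \<Rightarrow> 'a::comm_monoid_add \<Rightarrow> 'a" where
  "gmul k g = (\<Sum>i<k. g)"

definition group_exponent :: "'a::{ab_group_add,finite} itself \<Rightarrow> nat" where
  "group_exponent _ = (LEAST n. 0 < n \<and> (\<forall>g::'a. gmul n g = 0))"

definition units_mod :: "nat \<Rightarrow> nat set" where
  "units_mod n = {k. k < n \<and> coprime k n}"

definition chi8 :: "int \<Rightarrow> int" where
  "chi8 k = (if k mod 8 = 1 \<or> k mod 8 = 7 then 1
             else if k mod 8 = 3 \<or> k mod 8 = 5 then -1 else 0)"

definition jac4 :: "int \<Rightarrow> int" where
  "jac4 k = (if k mod 4 = 1 then 1 else if k mod 4 = 3 then -1 else 0)"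

definition pstar :: "nat \<Rightarrow> int" where
  "pstar p = (-1) ^ ((p - 1) div 2) * int p"

(* Delta = 2^w0 (-1)^w prod_{p in S} p*, where S = set of odd primes p_i with w_i = 1 *)
definition Delta :: "nat \<Rightarrow> nat \<Rightarrow> nat set \<Rightarrow> int" where
  "Delta w0 w S = 2 ^ w0 * (-1) ^ w * (\<Prod>p\<in>S. pstar p)"

definition H_Delta :: "nat \<Rightarrow> nat \<Rightarrow> nat \<Rightarrow> nat set \<Rightarrow> nat set" where
  "H_Delta n1 w0 w S = {k \<in> units_mod n1.
     chi8 (int k) ^ w0 * jac4 (int k) ^ w * (\<Prod>p\<in>S. Legendre (int k) (int p)) = 1}"

definition equivH :: "nat set \<Rightarrow> 'a::comm_monoid_add \<Rightarrow> 'a \<Rightarrow> bool" where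
  "equivH H g h \<longleftrightarrow> (\<exists>k\<in>H. g = gmul k h)"

definition union_of_classes :: "nat set \<Rightarrow> ('a::comm_monoid_add) set \<Rightarrow> bool" where
  "union_of_classes H C \<longleftrightarrow> (\<forall>g h. equivH H g h \<longrightarrow> (g \<in> C \<longleftrightarrow> h \<in> C))"

definition A_elem :: "('a::{ab_group_add,finite}) \<Rightarrow> ((complex, 'a) vec, 'a) vec" where
  "A_elem g = (\<chi> u v. if v - u = g then 1 else 0)"

definition A_set :: "('a::{ab_group_add,finite}) set \<Rightarrow> ((complex, 'a) vec, 'a) vec" where
  "A_set C = (\<Sum>g\<in>C. A_elem g)"

definition is_eigenvalue :: "complex^'n^'n \<Rightarrow> complex \<Rightarrow> bool" where
  "is_eigenvalue M c \<longleftrightarrow> (\<exists>v. v \<noteq> 0 \<and> M *v v = c *s v)"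

definition Q_sqrt :: "int \<Rightarrow> complex set" where
  "Q_sqrt D = {of_real a + of_real b * csqrt (of_int D) | a b. a \<in> \<rat> \<and> b \<in> \<rat>}"

definition int_mult_sqrt :: "int \<Rightarrow> complex set" where
  "int_mult_sqrt D = {of_int z * csqrt (of_int D) | z. True}"

end

theory Submission
  imports Defs "HOL-Computational_Algebra.Polynomial_Factorial"
    "HOL-Computational_Algebra.Field_as_Ring" "HOL-Computational_Algebra.Squarefree"
begin

text \<open>
  The eigenvalues of \<open>M\<close> are the character sums \<open>\<theta>(\<psi>) = \<Sum>\<^sub>g f(g) \<psi>(g)\<close> with
  \<open>f\<close> the signed indicator function of \<open>C1\<close> and \<open>C2\<close>, and the Galois conjugate of
  \<open>\<theta>(\<psi>)\<close> belonging to a unit \<open>k\<close> is \<open>\<Sum>\<^sub>g f(g) \<psi>(kg)\<close>. A product of quadratic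
  Gauss sums, of \<open>\<i>\<close> and of \<open>\<zeta>\<^sub>8 + \<zeta>\<^sub>8\<^sup>-\<^sup>1\<close> is a square root of \<open>\<Delta>\<close> which the
  conjugation \<open>k\<close> multiplies by the quadratic character defining \<open>H\<^sub>\<Delta>\<close>. So
  \<open>\<theta>(\<psi>) \<in> \<rat>(\<surd>\<Delta>)\<close> iff it is fixed by \<open>H\<^sub>\<Delta>\<close>, and \<open>\<theta>(\<psi>) \<in> \<rat>\<surd>\<Delta>\<close> iff
  moreover the other conjugations change its sign; since characters separate functions on
  \<open>G\<close>, these are the invariance of \<open>f\<close> under \<open>H\<^sub>\<Delta>\<close> and its antisymmetry under the other
  coset. Integrality of the coefficient of \<open>\<surd>\<Delta>\<close> holds because \<open>\<Delta>\<close> is squarefree.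
\<close>

section \<open>Roots of unity and cyclotomic integers\<close>

text \<open>The obstacle is that conjugation acts on expressions before it acts on numbers. A number
  is therefore carried inside a function \<open>F\<close> of the exponent: \<open>F 1\<close> is the
  number, \<open>F k\<close> its candidate conjugate. That a rational relation at 1 persists at
  every \<open>k\<close> coprime to \<open>n\<close> (\<open>cfam_vanish_coprime\<close>) is
  irreducibility of the cyclotomic polynomial in this language. The fixed field of \<open>H\<close>
  is reached through traces, whose rationality comes from Ramanujan sums. The square root of
  \<Delta> is identified only up to sign, a choice that neither Q(sqrt \<Delta>) nor the set of
  integer multiples of sqrt \<Delta> can see. Once this root is available, multiplicativity of the
  quadratic character on units and its value at -1 are read off from it.\<close>

definition urt :: "nat \<Rightarrow> complex" where
  "urt n = cis (2 * pi / real n)"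

lemma urt_power: "urt n ^ k = cis (2 * pi * real k / real n)"
  by (simp add: urt_def Complex.DeMoivre mult_ac)

lemma urt_nonzero [simp]: "urt n \<noteq> 0"
  by (simp add: urt_def)

lemma urt_pow_self [simp]: "n > 0 \<Longrightarrow> urt n ^ n = 1"
  by (simp add: urt_power)

lemma urt_pow_mod: "n > 0 \<Longrightarrow> urt n ^ (k mod n) = urt n ^ k"
  by (metis div_mult_mod_eq mult.commute mult_1 power_add power_mult power_one urt_pow_self)

lemma urt_pow_cong: "n > 0 \<Longrightarrow> [k = l] (mod n) \<Longrightarrow> urt n ^ k = urt n ^ l"
  by (metis cong_def urt_pow_mod)

lemma urt_roots:
  assumes "n > 0" "z ^ n = 1"
  obtains j where "j < n" "z = urt n ^ j"
proof -
  have "z \<in> (\<lambda>k. cis (2 * pi * real k / real n)) ` {..<n}"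
    using Complex.bij_betw_roots_unity[OF assms(1)] assms(2) by (auto simp: bij_betw_def)
  thus ?thesis using that by (auto simp: urt_power)
qed

lemma urt_pow_eq_1_iff:
  assumes "n > 0" shows "urt n ^ k = 1 \<longleftrightarrow> n dvd k"
proof
  assume "urt n ^ k = 1"
  hence "urt n ^ (k mod n) = urt n ^ 0" using assms by (simp add: urt_pow_mod)
  moreover have "inj_on (\<lambda>k. urt n ^ k) {..<n}"
    using Complex.bij_betw_roots_unity[OF assms] by (simp add: bij_betw_def urt_power)
  ultimately have "k mod n = 0" using assms by (auto simp: inj_on_def)
  thus "n dvd k" by blast
next
  assume "n dvd k" thus "urt n ^ k = 1" using assms by (auto simp: power_mult)
qed

lemma urt_pow_div:
  assumes "n > 0" "d dvd n" shows "urt n ^ d = urt (n div d)"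
  using assms unfolding urt_power by (auto simp: urt_def real_of_nat_div)

lemma urt_inverse_power:
  assumes "n > 0" "j \<le> n" shows "urt n ^ (n - j) = inverse (urt n ^ j)"
  using assms by (simp add: power_diff divide_inverse)

lemma sum_root_of_unity_powers:
  fixes z :: complex
  assumes "z ^ n = 1"
  shows "(\<Sum>j<n. z ^ j) = (if z = 1 then of_nat n else 0)"
  using assms by (simp add: geometric_sum)

text \<open>The family \<open>k \<mapsto> \<Sum>\<^sub>j c\<^sub>j w\<^bsup>jk\<^esup>\<close> records, for a primitive root of unity \<open>w\<close>, the value
  of a polynomial at \<open>w\<close> (for \<open>k = 1\<close>) together with its formal Galois conjugates, so that
  conjugation can be discussed before it is known to be well defined.\<close>
inductive_set cfam :: "complex set \<Rightarrow> complex \<Rightarrow> (nat \<Rightarrow> complex) set"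
  for R :: "complex set" and w :: complex where
  zero: "(\<lambda>k. 0) \<in> cfam R w"
| step: "F \<in> cfam R w \<Longrightarrow> c \<in> R \<Longrightarrow> (\<lambda>k. F k + c * w ^ (j * k)) \<in> cfam R w"

lemma cfam_monom: "c \<in> R \<Longrightarrow> (\<lambda>k. c * w ^ (j * k)) \<in> cfam R w"
  using cfam.step[OF cfam.zero, of c R w j] by simp

lemma cfam_const: "c \<in> R \<Longrightarrow> (\<lambda>k. c) \<in> cfam R w"
  using cfam_monom[of c R w 0] by simp

lemma cfam_add:
  assumes "F \<in> cfam R w" "G \<in> cfam R w" shows "(\<lambda>k. F k + G k) \<in> cfam R w"
  using assms(2)
proof induction
  case zero thus ?case using assms(1) by simp
next
  case (step G c j)
  from cfam.step[OF step.IH step.hyps(2), of j] show ?case by (simp add: add.assoc)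
qed

lemma cfam_sum:
  "(\<And>i. i \<in> A \<Longrightarrow> F i \<in> cfam R w) \<Longrightarrow> (\<lambda>k. \<Sum>i\<in>A. F i k) \<in> cfam R w"
  by (induction A rule: infinite_finite_induct) (simp_all add: cfam.zero cfam_add)

lemma cfam_mult_monom:
  assumes "\<And>a b. a \<in> R \<Longrightarrow> b \<in> R \<Longrightarrow> a * b \<in> R" "F \<in> cfam R w" "c \<in> R"
  shows "(\<lambda>k. F k * (c * w ^ (j * k))) \<in> cfam R w"
  using assms(2)
proof induction
  case zero thus ?case by (simp add: cfam.zero)
next
  case (step F b i)
  have "(\<lambda>k. F k * (c * w ^ (j * k)) + (b * c) * w ^ ((i + j) * k)) \<in> cfam R w"
    using step assms by (intro cfam.step) auto
  thus ?case by (simp add: algebra_simps power_add)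
qed

lemma cfam_mult:
  assumes "\<And>a b. a \<in> R \<Longrightarrow> b \<in> R \<Longrightarrow> a * b \<in> R" "F \<in> cfam R w" "G \<in> cfam R w"
  shows "(\<lambda>k. F k * G k) \<in> cfam R w"
  using assms(3)
proof induction
  case zero thus ?case by (simp add: cfam.zero)
next
  case (step G c j)
  have "(\<lambda>k. F k * G k + F k * (c * w ^ (j * k))) \<in> cfam R w"
    using step assms by (intro cfam_add cfam_mult_monom) auto
  thus ?case by (simp add: algebra_simps)
qed

lemma cfam_power:
  assumes "\<And>a b. a \<in> R \<Longrightarrow> b \<in> R \<Longrightarrow> a * b \<in> R" "1 \<in> R" "F \<in> cfam R w"
  shows "(\<lambda>k. F k ^ m) \<in> cfam R w"
  by (induction m) (use assms in \<open>auto intro!: cfam_mult cfam_const\<close>)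

lemma cfam_mono: "R \<subseteq> R' \<Longrightarrow> F \<in> cfam R w \<Longrightarrow> F \<in> cfam R' w"
  by (rotate_tac, induction rule: cfam.induct) (auto intro: cfam.intros)

lemma cfam_Ints_Rats: "F \<in> cfam \<int> w \<Longrightarrow> F \<in> cfam \<rat> w"
  by (rule cfam_mono[of \<int>]) (auto simp: Ints_def)

lemma cfam_cong:
  assumes "n > 0" "F \<in> cfam R (urt n)" "[k = l] (mod n)"
  shows "F k = F l"
  using assms(2)
proof induction
  case (step F c j)
  thus ?case using urt_pow_cong[OF assms(1) cong_scalar_left[OF assms(3)]] by simp
qed auto

section \<open>Rational numbers among the cyclotomic integers\<close>

interpretation cq: vector_space "\<lambda>(q::rat) (z::complex). of_rat q * z"
  by unfold_locales (simp_all add: algebra_simps of_rat_add of_rat_mult)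

text \<open>Extend \<open>{1}\<close> to a basis of the complex numbers over the rationals and take
  the coordinate at 1.\<close>

lemma rational_functional:
  "\<exists>l :: complex \<Rightarrow> rat. (\<forall>x y. l (x + y) = l x + l y) \<and> (\<forall>q x. l (of_rat q * x) = q * l x) \<and> l 1 = 1"
proof -
  have ind: "cq.independent {1::complex}"
    by (subst cq.dependent_single) simp
  define B where "B = cq.extend_basis {1::complex}"
  have B: "cq.independent B" "1 \<in> B" "\<And>x. x \<in> cq.span B"
    unfolding B_def using cq.independent_extend_basis[OF ind] cq.extend_basis_superset[OF ind]
      cq.span_extend_basis[OF ind] by auto
  show ?thesis
  proof (intro exI[of _ "\<lambda>x. cq.representation B x 1"] conjI allI)
    fix x y q
    show "cq.representation B (x + y) 1 = cq.representation B x 1 + cq.representation B y 1"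
      using cq.representation_add[OF B(1) B(3) B(3)] by simp
    show "cq.representation B (of_rat q * x) 1 = q * cq.representation B x 1"
      using cq.representation_scale[OF B(1) B(3), of q x] by simp
    show "cq.representation B 1 1 = 1"
      using cq.representation_basis[OF B(1,2)] by simp
  qed
qed

text \<open>In lowest terms the powers \<open>b ^ m\<close> of the denominator all divide
  \<open>N\<close>. For \<open>b \<ge> 2\<close> the choice \<open>m = N\<close> is already
  impossible, since \<open>b ^ N \<ge> 2 ^ N > N\<close>.\<close>

lemma rat_bounded_denominator_imp_int:
  fixes q :: rat
  assumes "N > 0" "\<And>m::nat. of_nat N * q ^ m \<in> \<int>"
  shows "q \<in> \<int>"
proof -
  obtain a b where q: "quotient_of q = (a, b)" by (cases "quotient_of q") auto
  have b: "b > 0" "coprime a b" using q quotient_of_denom_pos quotient_of_coprime by blast+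
  have qq: "q = of_int a / of_int b" using quotient_of_div[OF q] .
  have dv: "b ^ m dvd int N" for m
  proof -
    obtain z where z: "of_nat N * q ^ m = of_int z" using assms(2)[of m] by (auto elim: Ints_cases)
    hence "of_nat N * of_int a ^ m = (of_int z * of_int b ^ m :: rat)"
      using b by (simp add: qq field_simps)
    hence "of_int (int N * a ^ m) = (of_int (z * b ^ m) :: rat)" by simp
    hence "int N * a ^ m = z * b ^ m" by (simp only: of_int_eq_iff)
    hence "b ^ m dvd int N * a ^ m" by simp
    moreover have "coprime (b ^ m) (a ^ m)" using b by (simp add: coprime_commute)
    ultimately show ?thesis using coprime_dvd_mult_left_iff by blast
  qed
  have "b = 1"
  proof (rule ccontr)
    assume "b \<noteq> 1"
    hence b2: "b \<ge> 2" using b by simp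
    have "b ^ N \<le> int N" using dv[of N] assms(1) zdvd_imp_le by simp
    moreover have "int N < 2 ^ N" by (metis of_nat_less_two_power)
    moreover have "(2::int) ^ N \<le> b ^ N" using b2 by (intro power_mono) auto
    ultimately show False by simp
  qed
  thus ?thesis by (simp add: qq)
qed

lemma rat_finite_common_denominator:
  fixes A :: "rat set"
  assumes "finite A" obtains N :: nat where "N > 0" "\<And>q. q \<in> A \<Longrightarrow> of_nat N * q \<in> \<int>"
proof -
  have "\<exists>N>0. \<forall>q\<in>A. of_nat N * q \<in> (\<int> :: rat set)" using assms
  proof induction
    case (insert q A)
    then obtain N where N: "N > 0" "\<forall>q\<in>A. of_nat N * q \<in> (\<int>::rat set)" by auto
    obtain a b where q: "quotient_of q = (a, b)" by (cases "quotient_of q") auto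
    have b: "b > 0" using q quotient_of_denom_pos by blast
    have "of_nat (N * nat b) * q = of_int (int N * a)"
      using b quotient_of_div[OF q] by simp
    moreover have "of_nat (N * nat b) * x \<in> \<int>" if "x \<in> A" for x
    proof -
      have "of_nat (N * nat b) * x = of_nat (nat b) * (of_nat N * x)" by simp
      thus ?thesis using N(2) that by (metis Ints_mult Ints_of_nat)
    qed
    ultimately show ?case using N(1) b
      by (intro exI[of _ "N * nat b"]) (auto simp del: of_nat_mult)
  qed (auto intro: exI[of _ 1])
  thus ?thesis using that by blast
qed

text \<open>A rational-linear functional with value 1 at 1 maps the ring generated by the roots of unity
  into a lattice; all powers of a rational element of that ring lie in this lattice.\<close>
lemma cfam_rational_imp_int:
  assumes n: "n > 0" and F: "F \<in> cfam \<int> (urt n)" and rat: "F k \<in> \<rat>"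
  shows "F k \<in> \<int>"
proof -
  obtain l :: "complex \<Rightarrow> rat" where l: "\<And>x y. l (x + y) = l x + l y" "\<And>q x. l (of_rat q * x) = q * l x" "l 1 = 1"
    using rational_functional by auto
  obtain N where N0: "N > 0"
    "\<And>q. q \<in> (\<lambda>j. l (urt n ^ j)) ` {..<n} \<Longrightarrow> of_nat N * q \<in> \<int>"
    by (rule rat_finite_common_denominator[of "(\<lambda>j. l (urt n ^ j)) ` {..<n}"]) auto
  have N: "N > 0" "\<And>j. j < n \<Longrightarrow> of_nat N * l (urt n ^ j) \<in> \<int>"
    using N0 by blast+
  have l0: "l 0 = 0" using l(2)[of 0 1] by simp
  have lat: "of_nat N * l (G k) \<in> \<int>" if "G \<in> cfam \<int> (urt n)" for G
    using that
  proof induction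
    case (step F c j)
    obtain z where z: "c = of_rat (of_int z)" using step by (auto elim: Ints_cases)
    have "of_nat N * l (F k + c * urt n ^ (j * k))
        = of_nat N * l (F k) + of_int z * (of_nat N * l (urt n ^ ((j * k) mod n)))"
      unfolding l(1) z l(2) using urt_pow_mod[OF n] by (simp add: algebra_simps)
    thus ?case using step N(2)[of "(j * k) mod n"] n by simp
  qed (simp add: l0)
  obtain q where q: "F k = of_rat q" using rat by (auto elim: Rats_cases)
  have "of_nat N * q ^ m \<in> \<int>" for m
  proof -
    have "(\<lambda>k. F k ^ m) \<in> cfam \<int> (urt n)" using F by (intro cfam_power) auto
    from lat[OF this] have "of_nat N * l (of_rat (q ^ m) * 1) \<in> \<int>" by (simp add: q of_rat_power)
    thus ?thesis unfolding l by (simp add: l)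
  qed
  hence "q \<in> \<int>" using rat_bounded_denominator_imp_int[OF N(1)] by blast
  thus ?thesis by (auto simp: q elim!: Ints_cases)
qed

section \<open>Frobenius congruences modulo a prime\<close>

lemma prime_dvd_power_minus_self:
  fixes c :: int assumes "prime (p::nat)" shows "int p dvd c ^ p - c"
proof (cases "int p dvd c")
  case True
  moreover have "c dvd c ^ p" using assms by (simp add: dvd_power prime_gt_0_nat)
  ultimately show ?thesis using dvd_trans by (intro dvd_diff) blast+
next
  case False
  define a where "a = nat (c mod int p)"
  have p: "p > 0" using assms prime_gt_0_nat by blast
  have a: "int a = c mod int p" using p by (simp add: a_def)
  have "\<not> p dvd a" using False p by (metis a dvd_mod_iff int_dvd_int_iff dvd_refl)
  hence "[a ^ (p - 1) = 1] (mod p)" using fermat_theorem[OF assms] by blast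
  hence "[int a ^ (p - 1) = 1] (mod int p)" by (metis cong_int_iff of_nat_1 of_nat_power)
  moreover have ca: "[int a = c] (mod int p)" by (simp add: a)
  ultimately have "[c ^ (p - 1) = 1] (mod int p)" by (meson cong_pow cong_sym cong_trans)
  hence "[c * c ^ (p - 1) = c * 1] (mod int p)" by (rule cong_scalar_left)
  moreover have "c * c ^ (p - 1) = c ^ p" using p by (metis power_eq_if not_gr_zero)
  ultimately show ?thesis by (simp add: cong_iff_dvd_diff)
qed

text \<open>The inner binomial coefficients are divisible by \<open>p\<close>. The error is kept as
  a family \<open>H\<close> with integral coefficients, so that the congruence modulo
  \<open>p\<close> becomes an identity valid at all indices at once.\<close>

lemma cfam_binomial_prime:
  assumes p: "prime p" and F: "F \<in> cfam \<int> w" and G: "G \<in> cfam \<int> w"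
  obtains H where "H \<in> cfam \<int> w" "\<And>k. (F k + G k) ^ p = F k ^ p + G k ^ p + of_nat p * H k"
proof
  let ?H = "\<lambda>k. \<Sum>i\<in>{1..<p}. of_nat ((p choose i) div p) * (F k ^ i * G k ^ (p - i))"
  show "?H \<in> cfam \<int> w" using F G by (intro cfam_sum cfam_mult cfam_const cfam_power) auto
  fix k
  have p0: "p > 0" using p prime_gt_0_nat by blast
  have "(F k + G k) ^ p = (\<Sum>i\<in>{..p}. of_nat (p choose i) * F k ^ i * G k ^ (p - i))"
    by (rule binomial_ring)
  also have "{..p} = insert 0 (insert p {1..<p})" using p0 by auto
  also have "(\<Sum>i\<in>\<dots>. of_nat (p choose i) * F k ^ i * G k ^ (p - i))
     = F k ^ p + G k ^ p + (\<Sum>i\<in>{1..<p}. of_nat (p choose i) * F k ^ i * G k ^ (p - i))"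
    using p0 by simp
  also have "(\<Sum>i\<in>{1..<p}. of_nat (p choose i) * F k ^ i * G k ^ (p - i)) = of_nat p * ?H k"
    unfolding sum_distrib_left
  proof (rule sum.cong)
    fix i assume i: "i \<in> {1..<p}"
    have "p dvd (p choose i)" using i p by (intro dvd_choose_prime) auto
    hence "of_nat (p choose i) = (of_nat p * of_nat ((p choose i) div p) :: complex)"
      by (metis dvd_mult_div_cancel of_nat_mult)
    thus "of_nat (p choose i) * F k ^ i * G k ^ (p - i) =
       of_nat p * (of_nat ((p choose i) div p) * (F k ^ i * G k ^ (p - i)))"
      by simp
  qed simp
  finally show "(F k + G k) ^ p = F k ^ p + G k ^ p + of_nat p * ?H k" .
qed

text \<open>The \<open>p\<close>-th power fixes integral coefficients modulo \<open>p\<close> by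
  Fermat and sends \<open>w ^ (j * k)\<close> to \<open>w ^ (j * (k * p))\<close>. Modulo
  \<open>p\<close> it thus multiplies the index by \<open>p\<close>.\<close>

lemma cfam_frobenius:
  assumes p: "prime p" and F: "F \<in> cfam \<int> w"
  obtains H where "H \<in> cfam \<int> w" "\<And>k. F k ^ p = F (k * p) + of_nat p * H k"
proof -
  have "\<exists>H\<in>cfam \<int> w. \<forall>k. F k ^ p = F (k * p) + of_nat p * H k" using F
  proof induction
    case zero
    show ?case using p by (intro bexI[OF _ cfam.zero]) (auto simp: prime_gt_0_nat)
  next
    case (step F c j)
    then obtain H where H: "H \<in> cfam \<int> w" "\<forall>k. F k ^ p = F (k * p) + of_nat p * H k" by blast
    obtain z where z: "c = of_int z" using step by (auto elim: Ints_cases)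
    obtain d where "z ^ p - z = int p * d" using prime_dvd_power_minus_self[OF p] by blast
    hence "(of_int (z ^ p - z) :: complex) = of_int (int p * d)" by presburger
    hence d: "c ^ p = c + of_nat p * of_int d" by (simp add: z algebra_simps)
    obtain K where K: "K \<in> cfam \<int> w"
      "\<And>k. (F k + c * w ^ (j * k)) ^ p = F k ^ p + (c * w ^ (j * k)) ^ p + of_nat p * K k"
      using cfam_binomial_prime[OF p step.hyps(1) cfam_monom[OF step.hyps(2)]] by metis
    have "(F k + c * w ^ (j * k)) ^ p = F (k * p) + c * w ^ (j * (k * p))
       + of_nat p * (H k + of_int d * w ^ (j * p * k) + K k)" for k
    proof -
      have "(c * w ^ (j * k)) ^ p = (c + of_nat p * of_int d) * w ^ (j * (k * p))"
        by (simp add: power_mult_distrib d flip: power_mult) (simp add: mult_ac)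
      thus ?thesis unfolding K(2) using H(2) by (simp add: algebra_simps)
    qed
    moreover have "(\<lambda>k. H k + of_int d * w ^ (j * p * k) + K k) \<in> cfam \<int> w"
      using H(1) K(1) by (intro cfam_add cfam.step) auto
    ultimately show ?case by (intro bexI) auto
  qed
  thus ?thesis using that by blast
qed

section \<open>Irreducibility of cyclotomic polynomials and traces\<close>

lemma urt_pow_inj: "n > 0 \<Longrightarrow> i < n \<Longrightarrow> j < n \<Longrightarrow> urt n ^ i = urt n ^ j \<Longrightarrow> i = j"
  using Complex.bij_betw_roots_unity[of n] by (auto simp: bij_betw_def urt_power inj_on_def)

text \<open>By orthogonality each monomial contributes \<open>n\<close> times its coefficient or 0.
  The sum runs over all exponents modulo \<open>n\<close> and not only over the units, so it is not
  yet the field trace.\<close>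

lemma cfam_full_sum_rat:
  assumes n: "n > 0" and F: "F \<in> cfam \<rat> (urt n)"
  shows "(\<Sum>i<n. F i) \<in> \<rat>"
  using F
proof induction
  case (step F c j)
  have "(\<Sum>i<n. urt n ^ (j * i)) = (\<Sum>i<n. (urt n ^ j) ^ i)" by (simp add: power_mult)
  also have "\<dots> = (if urt n ^ j = 1 then of_nat n else 0)"
    using n by (intro sum_root_of_unity_powers) (metis mult.commute power_mult power_one urt_pow_self)
  finally have "(\<Sum>i<n. urt n ^ (j * i)) \<in> \<rat>" by simp
  thus ?case using step by (simp add: sum.distrib flip: sum_distrib_left)
qed simp

section \<open>Irreducibility by way of rational polynomials\<close>

definition qev :: "rat poly \<Rightarrow> complex \<Rightarrow> complex" where
  "qev P z = poly (map_poly of_rat P) z"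

lemma qev_0 [simp]: "qev 0 z = 0"
  by (simp add: qev_def)

lemma qev_pCons [simp]: "qev (pCons a P) z = of_rat a + z * qev P z"
  by (simp add: qev_def map_poly_pCons)

lemma qev_add [simp]: "qev (P + Q) z = qev P z + qev Q z"
proof (induction P arbitrary: Q)
  case (pCons a P)
  show ?case by (cases Q) (simp add: pCons.IH of_rat_add distrib_left)
qed simp

lemma qev_smult [simp]: "qev (Polynomial.smult c P) z = of_rat c * qev P z"
  by (induction P) (simp_all add: of_rat_mult algebra_simps)

lemma qev_mult [simp]: "qev (P * Q) z = qev P z * qev Q z"
  by (induction P) (simp_all add: algebra_simps)

lemma qev_monom [simp]: "qev (Polynomial.monom c m) z = of_rat c * z ^ m"
  by (induction m) (simp_all add: monom_0 monom_Suc)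

lemma qev_1 [simp]: "qev 1 z = 1"
  by (simp add: one_pCons)

lemma qev_diff [simp]: "qev (P - Q) z = qev P z - qev Q z"
  using qev_add[of "P - Q" Q z] by (simp add: algebra_simps)

text \<open>Passing to \<open>rat poly\<close> makes gcds and Bezout coefficients available for
  families.\<close>

lemma cfam_imp_qev:
  assumes "F \<in> cfam \<rat> w"
  obtains P where "\<And>k. F k = qev P (w ^ k)"
proof -
  have "\<exists>P. \<forall>k. F k = qev P (w ^ k)" using assms
  proof induction
    case zero thus ?case by (intro exI[of _ 0]) simp
  next
    case (step F c j)
    then obtain P where P: "\<forall>k. F k = qev P (w ^ k)" by blast
    obtain q where "c = of_rat q" using step by (auto elim: Rats_cases)
    thus ?case using P
      by (intro exI[of _ "P + Polynomial.monom q j"]) (simp add: mult.commute flip: power_mult)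
  qed
  thus ?thesis using that by blast
qed

lemma qev_in_cfam: "(\<lambda>k. qev P (w ^ k)) \<in> cfam \<rat> w"
proof (induction P)
  case (pCons a P)
  have "(\<lambda>k. of_rat a + (1 * w ^ (1 * k)) * qev P (w ^ k)) \<in> cfam \<rat> w"
    by (intro cfam_add cfam_const cfam_mult cfam_monom pCons.IH) auto
  thus ?case by simp
qed (simp add: cfam.zero)

text \<open>Separability of X^n - 1: a common divisor \<open>d\<close> enters with its square, so it
  divides the derivative n X^(n-1), hence also X times that derivative minus n (X^n - 1), which is
  the nonzero constant n.\<close>

lemma coprime_factors_of_unity_poly:
  fixes f h :: "rat poly"
  assumes n: "n > 0" and fh: "f * h = Polynomial.monom 1 n - 1"
  shows "coprime f h"
proof (rule coprimeI)
  fix d assume "d dvd f" "d dvd h"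
  then obtain a b where ab: "f = d * a" "h = d * b" by (auto elim!: dvdE)
  define c where "c = a * b"
  have Q: "Polynomial.monom 1 n - 1 = d * d * c" using fh ab by (simp add: c_def algebra_simps)
  have "pderiv (Polynomial.monom 1 n - 1 :: rat poly) = Polynomial.monom (of_nat n) (n - 1)"
    by (simp add: pderiv_diff pderiv_monom)
  moreover have "d dvd pderiv (d * d * c)" by (simp add: pderiv_mult)
  ultimately have "d dvd Polynomial.monom (of_nat n) (n - 1)" using Q by metis
  hence "d dvd Polynomial.monom 1 1 * Polynomial.monom (of_nat n) (n - 1) - Polynomial.smult (of_nat n) (Polynomial.monom 1 n - 1)"
    by (rule dvd_diff[OF dvd_mult Polynomial.dvd_smult]) (simp_all add: Q)
  also have "Polynomial.monom 1 1 * Polynomial.monom (of_nat n) (n - 1) - Polynomial.smult (of_nat n) (Polynomial.monom 1 n - 1)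
     = [:of_nat n :: rat:]"
    using n by (simp add: mult_monom smult_diff_right smult_monom one_pCons)
  also have "\<dots> dvd 1" using n by (simp add: is_unit_pCons_iff)
  finally show "is_unit d" .
qed

text \<open>If \<open>e\<close> is the idempotent of the group algebra of the cyclic group that vanishes exactly
  where \<open>F\<close> does, then \<open>n e\<close> has integral coefficients, so that Frobenius gives
  \<open>n e(kp) \<equiv> (n e(k))\<^sup>p\<close> modulo \<open>p\<close>, and \<open>e\<close> only takes the values 0 and 1.\<close>
lemma cfam_vanish_prime:
  assumes n: "n > 0" and p: "prime p" "\<not> p dvd n"
    and F: "F \<in> cfam \<rat> (urt n)" and F0: "F k = 0"
  shows "F (k * p) = 0"
proof -
  let ?w = "urt n"
  have wn: "(?w ^ i) ^ n = 1" for i using n by (metis mult.commute power_mult power_one urt_pow_self)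
  obtain P where P: "\<And>k. F k = qev P (?w ^ k)" using cfam_imp_qev[OF F] by blast
  define Q :: "rat poly" where "Q = Polynomial.monom 1 n - 1"
  have Q: "qev Q z = z ^ n - 1" for z by (simp add: Q_def)
  \<comment> \<open>Among the \<open>n\<close>-th roots of unity, \<open>f\<close> vanishes exactly
    where \<open>F\<close> does, and it divides X^n - 1, which supplies the complementary factor
    \<open>h\<close>.\<close>
  define f where "f = gcd P Q"
  obtain h where h: "Q = f * h" unfolding f_def using gcd_dvd2[of P Q] by (rule dvdE)
  have cop: "coprime f h" using coprime_factors_of_unity_poly[OF n, of f h] h by (simp add: Q_def)
  define u v where "u = fst (bezout_coefficients f h)" and "v = snd (bezout_coefficients f h)"
  have uv: "u * f + v * h = 1" using bezout_coefficients_fst_snd[of f h] cop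
    by (simp add: u_def v_def)
  define s t where "s = fst (bezout_coefficients P Q)" and "t = snd (bezout_coefficients P Q)"
  have st: "s * P + t * Q = f" using bezout_coefficients_fst_snd[of P Q]
    by (simp add: s_def t_def f_def)
  have fP: "qev f (?w ^ i) = 0 \<longleftrightarrow> F i = 0" for i
  proof
    assume "F i = 0"
    thus "qev f (?w ^ i) = 0" unfolding st[symmetric] by (simp add: P Q wn)
  next
    assume "qev f (?w ^ i) = 0"
    moreover have "f dvd P" by (simp add: f_def)
    ultimately show "F i = 0" unfolding P by (auto elim!: dvdE)
  qed
  \<comment> \<open>At each \<open>n\<close>-th root of unity exactly one of \<open>f\<close> and
    \<open>h\<close> vanishes, so the relation \<open>u * f + v * h = 1\<close> forces
    \<open>u * f\<close> to be 0 or 1 there.\<close>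
  define e where "e = (\<lambda>i. qev (u * f) (?w ^ i))"
  have e_fam: "e \<in> cfam \<rat> ?w" unfolding e_def by (rule qev_in_cfam)
  have e01: "e i = (if F i = 0 then 0 else 1)" for i
  proof -
    have "qev f (?w ^ i) * qev h (?w ^ i) = 0"
      using h Q[of "?w ^ i"] wn by (metis cancel_comm_monoid_add_class.diff_cancel qev_mult)
    moreover have "qev u (?w ^ i) * qev f (?w ^ i) + qev v (?w ^ i) * qev h (?w ^ i) = 1"
      using uv by (metis qev_1 qev_add qev_mult)
    ultimately show ?thesis using fP[of i] by (auto simp: e_def)
  qed
  \<comment> \<open>The discrete Fourier transform of \<open>e\<close>, that is, \<open>n\<close>
    times its coefficients in the group algebra; \<open>n - j\<close> stands for the exponent
    \<open>-j\<close>.\<close>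
  define E where "E = (\<lambda>j. \<Sum>i<n. e i * ?w ^ ((n - j) * i))"
  have E_int: "E j \<in> \<int>" for j
  proof -
    have "(\<lambda>k. e k * (1 * ?w ^ ((n - j) * k))) \<in> cfam \<rat> ?w"
      by (intro cfam_mult e_fam cfam_monom) auto
    from cfam_full_sum_rat[OF n this] have rat: "E j \<in> \<rat>" by (simp add: E_def)
    \<comment> \<open>The same sum read differently: the values \<open>e i\<close>, being 0 or 1,
      now serve as integral coefficients, and \<open>E j\<close> is the value at index 1.
      Rationality was obtained with \<open>e\<close> as a family.\<close>
    have "(\<lambda>k. \<Sum>i<n. e i * ?w ^ (((n - j) * i) * k)) \<in> cfam \<int> ?w"
      by (intro cfam_sum cfam_monom) (simp add: e01)
    from cfam_rational_imp_int[OF n this, of 1] rat show ?thesis by (simp add: E_def)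
  qed
  define G where "G = (\<lambda>k. \<Sum>j<n. E j * ?w ^ (j * k))"
  have G_fam: "G \<in> cfam \<int> ?w" unfolding G_def by (intro cfam_sum cfam_monom E_int)
  have G: "G k = of_nat n * e k" for k
  proof -
    have "G k = (\<Sum>j<n. \<Sum>i<n. e i * (?w ^ k / ?w ^ i) ^ j)"
      unfolding G_def E_def sum_distrib_right
    proof (intro sum.cong refl)
      fix i j assume j: "j \<in> {..<n}"
      have "?w ^ ((n - j) * i) = (?w ^ i) ^ n / (?w ^ i) ^ j"
        using j by (subst mult.commute) (simp add: power_mult power_diff)
      thus "e i * ?w ^ ((n - j) * i) * ?w ^ (j * k) = e i * (?w ^ k / ?w ^ i) ^ j"
        by (simp add: wn power_divide mult.commute[of j k] power_mult)
    qed
    also have "\<dots> = (\<Sum>i<n. \<Sum>j<n. e i * (?w ^ k / ?w ^ i) ^ j)" by (rule sum.swap)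
    also have "\<dots> = (\<Sum>i<n. if i = k mod n then of_nat n * e i else 0)"
    proof (intro sum.cong refl)
      fix i assume i: "i \<in> {..<n}"
      have iff: "?w ^ k / ?w ^ i = 1 \<longleftrightarrow> i = k mod n"
        using urt_pow_inj[OF n, of i "k mod n"] i n by (auto simp: urt_pow_mod divide_eq_1_iff)
      have "(\<Sum>j<n. (?w ^ k / ?w ^ i) ^ j) = (if ?w ^ k / ?w ^ i = 1 then of_nat n else 0)"
        by (rule sum_root_of_unity_powers) (simp add: power_divide wn)
      thus "(\<Sum>j<n. e i * (?w ^ k / ?w ^ i) ^ j) = (if i = k mod n then of_nat n * e i else 0)"
        unfolding iff by (simp flip: sum_distrib_left)
    qed
    also have "\<dots> = of_nat n * e (k mod n)" using n by simp
    also have "e (k mod n) = e k" using cfam_cong[OF n e_fam] by (metis cong_mod_left cong_refl)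
    finally show ?thesis .
  qed
  obtain H where H: "H \<in> cfam \<int> ?w" "\<And>k. G k ^ p = G (k * p) + of_nat p * H k"
    by (rule cfam_frobenius[OF p(1) G_fam]) blast
  have p0: "p > 0" using p prime_gt_0_nat by blast
  show ?thesis
  proof (rule ccontr)
    assume "F (k * p) \<noteq> 0"
    hence "G (k * p) = of_nat n" by (simp add: G e01)
    moreover have "G k = 0" using F0 by (simp add: G e01)
    ultimately have "of_nat n + of_nat p * H k = 0"
      using H(2)[of k] p0 by (simp add: zero_power)
    hence Hk: "H k = - of_nat n / of_nat p" using p0 by (simp add: field_simps eq_neg_iff_add_eq_0)
    hence "H k \<in> \<rat>" by simp
    from cfam_rational_imp_int[OF n H(1) this] obtain z where "H k = of_int z" by (auto elim: Ints_cases)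
    hence "(of_int (- int n) :: complex) = of_int (int p * z)" using Hk p0 by (simp add: field_simps)
    hence "- int n = int p * z" by (simp only: of_int_eq_iff)
    hence "int p dvd int n" by (metis dvd_minus_iff dvd_triv_left)
    thus False using p by simp
  qed
qed

text \<open>Split \<open>k\<close> into primes, none of which divides \<open>n\<close>, and move
  along one prime at a time; the starting index \<open>l\<close> is generalised for this. The index
  0 is coprime to \<open>n\<close> only if \<open>n = 1\<close>.\<close>

lemma cfam_vanish_coprime:
  assumes n: "n > 0" and F: "F \<in> cfam \<rat> (urt n)" and F0: "F 1 = 0" and k: "coprime k n"
  shows "F k = 0"
proof (cases "k = 0")
  case True
  hence "n = 1" using k by simp
  thus ?thesis using cfam_cong[OF n F, of k 1] F0 by simp
next
  case False
  have "F (l * k) = 0" if "F l = 0" for l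
    using False k that
  proof (induction k arbitrary: l rule: less_induct)
    case (less k)
    show ?case
    proof (cases "k = 1")
      case False
      then obtain p where p: "prime p" "p dvd k" using prime_factor_nat by blast
      then obtain m where m: "k = p * m" by blast
      have "\<not> p dvd n" using p less.prems(2) by (meson coprime_common_divisor_nat not_prime_1 coprime_def not_prime_unit)
      hence "F (l * p) = 0" using cfam_vanish_prime[OF n p(1) _ F] less.prems by blast
      moreover have "m < k" "m \<noteq> 0" "coprime m n" using m less.prems p prime_gt_1_nat by auto
      ultimately have "F (l * p * m) = 0" using less.IH by blast
      thus ?thesis by (simp add: m mult.assoc)
    qed (use less in simp)
  qed
  from this[of 1] F0 show ?thesis by simp
qed

text \<open>Group the full sum over exponents by \<open>gcd k n = d\<close>. The group of
  \<open>d\<close> is the corresponding sum for \<open>n div d\<close>, rational by induction if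
  \<open>d > 1\<close>; what remains is the group \<open>d = 1\<close>.\<close>

lemma ramanujan_sum_rat:
  assumes "n > 0" shows "(\<Sum>k\<in>totatives n. urt n ^ (j * k)) \<in> \<rat>"
  using assms
proof (induction n rule: less_induct)
  case (less n)
  have part: "(\<Sum>k | k \<in> {0<..n} \<and> gcd k n = d. urt n ^ (j * k))
      = (\<Sum>k\<in>totatives (n div d). urt (n div d) ^ (j * k))" if d: "d dvd n" for d
  proof -
    have "(\<Sum>k\<in>totatives (n div d). urt (n div d) ^ (j * k)) =
       (\<Sum>k\<in>totatives (n div d). urt n ^ (j * (k * d)))"
      by (simp add: power_mult mult_ac flip: urt_pow_div[OF less.prems d])
         (simp add: mult_ac flip: power_mult)
    also have "\<dots> = (\<Sum>k | k \<in> {0<..n} \<and> gcd k n = d. urt n ^ (j * k))"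
      using sum.reindex_bij_betw[OF bij_betw_totatives_gcd_eq[OF d less.prems], of "\<lambda>k. urt n ^ (j * k)"]
      by (simp add: mult_ac)
    finally show ?thesis by simp
  qed
  have "(\<Sum>k\<in>{0<..n}. urt n ^ (j * k)) = (\<Sum>i<n. urt n ^ (j * i))"
  proof -
    \<comment> \<open>The ranges differ by exchanging the exponents 0 and \<open>n\<close>, which
      give equal powers.\<close>
    have "{0<..n} = insert n ({..<n} - {0})" "{..<n} = insert 0 ({..<n} - {0})" using less.prems by auto
    moreover have "urt n ^ (j * n) = 1" using less.prems by (simp add: urt_pow_eq_1_iff)
    ultimately show ?thesis
      by (smt (verit) finite_Diff finite_lessThan insertE DiffE insert_iff lessThan_iff less_irrefl mult_0_right power_0 sum.insert)
  qed
  moreover have "(\<lambda>k. 1 * urt n ^ (j * k)) \<in> cfam \<rat> (urt n)" by (intro cfam_monom) auto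
  ultimately have tot: "(\<Sum>k\<in>{0<..n}. urt n ^ (j * k)) \<in> \<rat>"
    using cfam_full_sum_rat[OF less.prems] by simp
  have "(\<Sum>k\<in>{0<..n}. urt n ^ (j * k))
     = (\<Sum>d | d dvd n. \<Sum>k | k \<in> {0<..n} \<and> gcd k n = d. urt n ^ (j * k))"
    using less.prems by (intro sum.group[symmetric]) auto
  also have "\<dots> = (\<Sum>d | d dvd n. \<Sum>k\<in>totatives (n div d). urt (n div d) ^ (j * k))"
    by (intro sum.cong refl part) auto
  also have "{d. d dvd n} = insert 1 ({d. d dvd n} - {1})" by auto
  also have "(\<Sum>d\<in>\<dots>. \<Sum>k\<in>totatives (n div d). urt (n div d) ^ (j * k))
    = (\<Sum>k\<in>totatives n. urt n ^ (j * k)) +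
      (\<Sum>d\<in>{d. d dvd n} - {1}. \<Sum>k\<in>totatives (n div d). urt (n div d) ^ (j * k))"
    using less.prems by (subst sum.insert) auto
  finally have "(\<Sum>k\<in>totatives n. urt n ^ (j * k)) = (\<Sum>k\<in>{0<..n}. urt n ^ (j * k)) -
     (\<Sum>d\<in>{d. d dvd n} - {1}. \<Sum>k\<in>totatives (n div d). urt (n div d) ^ (j * k))" by simp
  moreover have "(\<Sum>d\<in>{d. d dvd n} - {1}. \<Sum>k\<in>totatives (n div d). urt (n div d) ^ (j * k)) \<in> \<rat>"
  proof (rule Rats_sum)
    fix d assume d: "d \<in> {d. d dvd n} - {1}"
    hence "d > 1" using less.prems by (metis DiffE One_nat_def dvd_pos_nat insertI1 mem_Collect_eq nat_neq_iff less_one)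
    hence "n div d < n" "n div d > 0" using d less.prems by (auto simp: dvd_imp_le div_greater_zero_iff)
    thus "(\<Sum>k\<in>totatives (n div d). urt (n div d) ^ (j * k)) \<in> \<rat>" using less.IH by blast
  qed
  ultimately show ?case using tot by simp
qed

lemma cfam_trace_rat:
  assumes n: "n > 0" and F: "F \<in> cfam \<rat> (urt n)"
  shows "(\<Sum>k\<in>totatives n. F k) \<in> \<rat>"
  using F
proof induction
  case (step F c j)
  thus ?case using ramanujan_sum_rat[OF n, of j] by (simp add: sum.distrib flip: sum_distrib_left)
qed simp

section \<open>Quadratic Gauss sums\<close>

lemma Legendre_cong: "[a = b] (mod p) \<Longrightarrow> Legendre a p = Legendre b p"
  unfolding Legendre_def QuadRes_def by (smt (verit) cong_sym cong_trans)

lemma Legendre_values: "\<not> p dvd a \<Longrightarrow> Legendre a p \<in> {1, -1}"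
  by (auto simp: Legendre_def cong_0_iff)

lemma sign_eq_if_dvd_diff:
  fixes a b :: int
  assumes "a \<in> {1, -1}" "b \<in> {1, -1}" "int p dvd a - b" "2 < p"
  shows "a = b"
proof (rule ccontr)
  assume "a \<noteq> b"
  hence "\<bar>int p\<bar> \<le> \<bar>a - b\<bar>" using assms(3) by (intro dvd_imp_le_int) auto
  thus False using assms by auto
qed

lemma coprime_prime_right:
  fixes a p :: nat assumes "prime p" "\<not> p dvd a" shows "coprime a p"
  using prime_imp_coprime[OF assms] by (simp add: coprime_commute)

text \<open>By Euler's criterion both sides are congruent modulo \<open>p\<close>; as signs that
  agree modulo \<open>p > 2\<close> they are equal.\<close>

lemma Legendre_mult:
  assumes p: "prime p" "2 < p"
  shows "Legendre (a * b) (int p) = Legendre a (int p) * Legendre b (int p)"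
proof (cases "int p dvd a \<or> int p dvd b")
  case True thus ?thesis by (auto simp: Legendre_def cong_0_iff)
next
  case False
  hence ab: "\<not> int p dvd a * b" using p by (simp add: prime_dvd_mult_iff)
  have "[Legendre (a * b) (int p) = (a * b) ^ ((p - 1) div 2)] (mod int p)"
    using euler_criterion[OF p] by simp
  moreover have "[Legendre a (int p) * Legendre b (int p) = a ^ ((p - 1) div 2) * b ^ ((p - 1) div 2)] (mod int p)"
    using euler_criterion[OF p] by (intro cong_mult)
  ultimately have "[Legendre (a * b) (int p) = Legendre a (int p) * Legendre b (int p)] (mod int p)"
    by (metis cong_sym cong_trans power_mult_distrib)
  hence dvd: "int p dvd Legendre (a * b) (int p) - Legendre a (int p) * Legendre b (int p)"
    by (simp add: cong_iff_dvd_diff)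
  have "Legendre (a * b) (int p) \<in> {1, -1}" "Legendre a (int p) \<in> {1, -1}" "Legendre b (int p) \<in> {1, -1}"
    using False ab Legendre_values by blast+
  thus ?thesis using dvd p by (intro sign_eq_if_dvd_diff[of _ _ p]) auto
qed

lemma Legendre_minus_one:
  assumes p: "prime p" "2 < p"
  shows "Legendre (-1) (int p) = (-1) ^ ((p - 1) div 2)"
proof -
  have dvd: "int p dvd Legendre (-1) (int p) - (-1) ^ ((p - 1) div 2)"
    using euler_criterion[OF p, of "-1"] by (simp add: cong_iff_dvd_diff)
  have "\<not> int p dvd -1" using p by auto
  hence "Legendre (-1) (int p) \<in> {1, -1}" by (rule Legendre_values)
  moreover have "(-1::int) ^ ((p - 1) div 2) \<in> {1, -1}" by (simp add: minus_one_power_iff)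
  ultimately show ?thesis using dvd p by (intro sign_eq_if_dvd_diff[of _ _ p])
qed

text \<open>Squaring on the nonzero residues is not injective, since 1 and \<open>p - 1\<close> have
  equal squares; on a finite set it is then not surjective.\<close>

lemma exists_nonresidue:
  assumes p: "prime p" "2 < p"
  obtains a where "a < p" "Legendre (int a) (int p) = -1"
proof -
  let ?f = "\<lambda>x. x * x mod p"
  have p0: "p > 0" using p by simp
  have maps: "?f ` {1..<p} \<subseteq> {1..<p}"
  proof safe
    fix x assume x: "x \<in> {1..<p}"
    hence "\<not> p dvd x" by (auto dest: dvd_imp_le)
    hence "\<not> p dvd x * x" using p by (simp add: prime_dvd_mult_iff)
    thus "?f x \<in> {1..<p}" using p0 by (auto simp: dvd_eq_mod_eq_0 Suc_le_eq)
  qed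
  have "?f 1 = ?f (p - 1)"
  proof -
    have "[int (p - 1) = -1] (mod int p)" using p by (simp add: of_nat_diff cong_iff_dvd_diff)
    hence "[int (p - 1) * int (p - 1) = -1 * -1] (mod int p)" by (intro cong_mult)
    hence "[int ((p - 1) * (p - 1)) = int 1] (mod int p)" by simp
    hence "[(p - 1) * (p - 1) = 1] (mod p)" by (simp only: cong_int_iff)
    thus ?thesis by (simp add: cong_def)
  qed
  moreover have "1 \<in> {1..<p}" "p - 1 \<in> {1..<p}" "1 \<noteq> p - 1" using p by auto
  ultimately have "\<not> inj_on ?f {1..<p}" by (meson inj_onD)
  hence "?f ` {1..<p} \<noteq> {1..<p}" using finite_surj_inj[of "{1..<p}" ?f] by auto
  then obtain a where a: "a \<in> {1..<p}" "a \<notin> ?f ` {1..<p}" using maps by blast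
  have nd: "\<not> int p dvd int a" using a by (auto dest: dvd_imp_le)
  have "\<not> QuadRes (int p) (int a)"
  proof
    assume "QuadRes (int p) (int a)"
    then obtain y where y: "[y ^ 2 = int a] (mod int p)" by (auto simp: QuadRes_def)
    define x where "x = nat (y mod int p)"
    have x: "int x = y mod int p" "x < p" using p0 by (auto simp: x_def nat_less_iff)
    have "[int x ^ 2 = y ^ 2] (mod int p)" by (intro cong_pow) (simp add: x)
    hence "[int x ^ 2 = int a] (mod int p)" using y cong_trans by blast
    hence c: "[x * x = a] (mod p)" by (simp add: power2_eq_square flip: of_nat_mult cong_int_iff)
    hence fx: "?f x = a" using a by (simp add: cong_def)
    hence "x \<noteq> 0" using a by (auto intro: gr0I)
    thus False using a fx x by (auto simp: image_iff)
  qed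
  hence "Legendre (int a) (int p) = -1" using nd by (simp add: Legendre_def cong_0_iff)
  thus ?thesis using that a by auto
qed

text \<open>The root of unity is an argument, so that conjugation is the passage from
  \<open>z\<close> to \<open>z ^ a\<close>.\<close>

definition gauss_sum :: "nat \<Rightarrow> complex \<Rightarrow> complex" where
  "gauss_sum p z = (\<Sum>j<p. of_int (Legendre (int j) (int p)) * z ^ j)"

lemma root_pow_mod:
  fixes z :: complex assumes "z ^ p = 1" shows "z ^ (k mod p) = z ^ k"
  by (metis assms div_mult_mod_eq mult.commute mult_1 power_add power_mult power_one)

lemma bij_betw_mult_mod:
  assumes "coprime a n" "n > (0::nat)" shows "bij_betw (\<lambda>j. a * j mod n) {..<n} {..<n}"
proof -
  have "inj_on (\<lambda>j. a * j mod n) {..<n}"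
  proof (rule inj_onI)
    fix x y assume xy: "x \<in> {..<n}" "y \<in> {..<n}" "a * x mod n = a * y mod n"
    hence "[a * x = a * y] (mod n)" by (simp add: cong_def)
    hence "[x = y] (mod n)" using assms cong_mult_lcancel_nat by blast
    thus "x = y" using xy by (simp add: cong_def)
  qed
  moreover have "(\<lambda>j. a * j mod n) ` {..<n} \<subseteq> {..<n}" using assms by auto
  ultimately show ?thesis by (simp add: bij_betw_def endo_inj_surj)
qed

text \<open>Reindex by multiplication with \<open>a\<close> modulo \<open>p\<close>. This puts the
  symbol of \<open>a\<close> on the other side, where it can be moved back because its square is
  1.\<close>

lemma gauss_sum_power:
  assumes p: "prime p" "2 < p" and z: "z ^ p = 1" and a: "coprime a p"
  shows "gauss_sum p (z ^ a) = of_int (Legendre (int a) (int p)) * gauss_sum p z"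
proof -
  let ?L = "\<lambda>j. of_int (Legendre (int j) (int p)) :: complex"
  have L: "?L (a * j mod p) = ?L a * ?L j" for j
  proof -
    have "Legendre (int (a * j mod p)) (int p) = Legendre (int a * int j) (int p)"
      by (rule Legendre_cong) (simp add: zmod_int)
    thus ?thesis using Legendre_mult[OF p] by simp
  qed
  have "gauss_sum p z = (\<Sum>j<p. ?L (a * j mod p) * z ^ (a * j mod p))"
    unfolding gauss_sum_def using p
    by (intro sum.reindex_bij_betw[OF bij_betw_mult_mod[OF a], symmetric]) simp
  also have "\<dots> = (\<Sum>j<p. ?L a * (?L j * (z ^ a) ^ j))"
    by (intro sum.cong refl) (simp only: L root_pow_mod[OF z] power_mult mult.assoc)
  also have "\<dots> = ?L a * gauss_sum p (z ^ a)" by (simp add: gauss_sum_def sum_distrib_left)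
  finally have "?L a * gauss_sum p z = (?L a * ?L a) * gauss_sum p (z ^ a)" by simp
  moreover have "\<not> p dvd a" using a p by (metis coprime_absorb_right coprime_commute not_prime_unit)
  hence "Legendre (int a) (int p) \<in> {1, -1}" by (intro Legendre_values) simp
  hence "?L a * ?L a = 1" by auto
  ultimately show ?thesis by simp
qed

text \<open>For a nonresidue \<open>a\<close> the substitution rule at \<open>z = 1\<close> says
  that the sum equals its own negative.\<close>

lemma gauss_sum_1:
  assumes p: "prime p" "2 < p" shows "gauss_sum p 1 = 0"
proof -
  obtain a where a: "a < p" "Legendre (int a) (int p) = -1" using exists_nonresidue[OF p] .
  have "\<not> p dvd a" using a by (auto simp: Legendre_def cong_0_iff split: if_splits)
  hence "coprime a p" using p by (intro coprime_prime_right)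
  from gauss_sum_power[OF p _ this, of 1] have "gauss_sum p 1 = - gauss_sum p 1" using a by simp
  thus ?thesis by simp
qed

text \<open>Evaluate the sum over \<open>a\<close> of the products of the Gauss sums at
  \<open>?w ^ a\<close> and at its inverse in two ways, with \<open>p - 1\<close> playing the role
  of -1. The substitution rule gives \<open>p - 1\<close> times the symbol of -1 times the square;
  expansion and orthogonality give \<open>(p - 1) * p\<close>.\<close>

lemma gauss_sum_square:
  assumes p: "prime p" "2 < p"
  shows "gauss_sum p (urt p) ^ 2 = of_int (pstar p)"
proof -
  let ?L = "\<lambda>j. of_int (Legendre (int j) (int p)) :: complex"
  let ?w = "urt p"
  let ?g = "gauss_sum p ?w"
  have p0: "p > 0" using p by simp
  have wp: "?w ^ p = 1" "(?w ^ i) ^ p = 1" for i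
    using p0 by (simp_all add: urt_pow_eq_1_iff flip: power_mult)
  have L2: "?L a * ?L a = (if a = 0 then 0 else 1)" if "a < p" for a
  proof (cases "a = 0")
    case False
    hence "\<not> int p dvd int a" using that by (auto dest: dvd_imp_le)
    from Legendre_values[OF this] show ?thesis using False by auto
  qed (simp add: Legendre_def)
  have "[int (p - 1) = -1] (mod int p)" using p by (simp add: of_nat_diff cong_iff_dvd_diff)
  hence Lm: "Legendre (int (p - 1)) (int p) = (-1) ^ ((p - 1) div 2)"
    using Legendre_cong Legendre_minus_one[OF p] by metis
  have cp: "coprime (p - 1) p" using p0 by (rule coprime_diff_one_left_nat)
  have "(\<Sum>a<p. gauss_sum p (?w ^ a) * gauss_sum p (?w ^ (a * (p - 1))))
     = (\<Sum>a<p. (if a = 0 then 0 else 1) * (?L (p - 1) * ?g ^ 2))"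
  proof (intro sum.cong refl)
    fix a assume a: "a \<in> {..<p}"
    show "gauss_sum p (?w ^ a) * gauss_sum p (?w ^ (a * (p - 1))) = (if a = 0 then 0 else 1) * (?L (p - 1) * ?g ^ 2)"
    proof (cases "a = 0")
      case True thus ?thesis using gauss_sum_1[OF p] by simp
    next
      case False
      hence "\<not> p dvd a" using a by (auto dest: dvd_imp_le)
      hence c: "coprime a p" using p by (intro coprime_prime_right)
      have "gauss_sum p (?w ^ (a * (p - 1))) = ?L (p - 1) * gauss_sum p (?w ^ a)"
        using gauss_sum_power[OF p wp(2) cp, of a] by (simp add: power_mult)
      moreover have "gauss_sum p (?w ^ a) = ?L a * ?g" by (rule gauss_sum_power[OF p wp(1) c])
      ultimately have "gauss_sum p (?w ^ a) * gauss_sum p (?w ^ (a * (p - 1))) = (?L a * ?L a) * (?L (p - 1) * ?g ^ 2)"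
        by (simp add: power2_eq_square)
      thus ?thesis using L2 a by simp
    qed
  qed
  also have "\<dots> = (\<Sum>a<p. if a = 0 then 0 else 1) * (?L (p - 1) * ?g ^ 2)"
    by (rule sum_distrib_right[symmetric])
  finally have e1: "(\<Sum>a<p. gauss_sum p (?w ^ a) * gauss_sum p (?w ^ (a * (p - 1))))
      = (\<Sum>a<p. if a = 0 then 0 else 1) * (?L (p - 1) * ?g ^ 2)" .
  have "(\<Sum>a<p. gauss_sum p (?w ^ a) * gauss_sum p (?w ^ (a * (p - 1))))
     = (\<Sum>a<p. \<Sum>j<p. \<Sum>l<p. ?L j * ?L l * (?w ^ (j + l * (p - 1))) ^ a)"
    unfolding gauss_sum_def sum_product
  proof (intro sum.cong refl)
    fix a j l
    have "(z ^ a) ^ j * (z ^ (a * q)) ^ l = (z ^ (j + l * q)) ^ a" for z :: complex and q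
      by (simp add: algebra_simps power_add flip: power_mult)
    from this[of ?w "p - 1"]
    show "?L j * (?w ^ a) ^ j * (?L l * (?w ^ (a * (p - 1))) ^ l) = ?L j * ?L l * (?w ^ (j + l * (p - 1))) ^ a"
      by (simp only: mult_ac)
  qed
  also have "\<dots> = (\<Sum>j<p. \<Sum>a<p. \<Sum>l<p. ?L j * ?L l * (?w ^ (j + l * (p - 1))) ^ a)"
    by (rule sum.swap)
  also have "\<dots> = (\<Sum>j<p. \<Sum>l<p. \<Sum>a<p. ?L j * ?L l * (?w ^ (j + l * (p - 1))) ^ a)"
    by (intro sum.cong refl sum.swap)
  also have "\<dots> = (\<Sum>j<p. \<Sum>l<p. if l = j then of_nat p * (?L j * ?L l) else 0)"
  proof (intro sum.cong refl)
    fix j l assume jl: "j \<in> {..<p}" "l \<in> {..<p}"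
    have pm: "int (p - 1) = int p - 1" using p0 by simp
    have "p dvd j + l * (p - 1) \<longleftrightarrow> int p dvd int (j + l * (p - 1))" by presburger
    also have "int (j + l * (p - 1)) = int j - int l + int p * int l"
      unfolding of_nat_add of_nat_mult pm by (simp add: algebra_simps)
    also have "int p dvd \<dots> \<longleftrightarrow> int p dvd int j - int l" by (rule dvd_add_left_iff) simp
    also have "\<dots> \<longleftrightarrow> l = j" using jl by (auto simp: cong_int_iff cong_def simp flip: cong_iff_dvd_diff)
    finally have iff: "?w ^ (j + l * (p - 1)) = 1 \<longleftrightarrow> l = j" using p0 by (simp add: urt_pow_eq_1_iff)
    have "(\<Sum>a<p. (?w ^ (j + l * (p - 1))) ^ a) = (if l = j then of_nat p else 0)"
      unfolding iff[symmetric] by (rule sum_root_of_unity_powers) (rule wp)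
    thus "(\<Sum>a<p. ?L j * ?L l * (?w ^ (j + l * (p - 1))) ^ a) = (if l = j then of_nat p * (?L j * ?L l) else 0)"
      by (simp flip: sum_distrib_left)
  qed
  also have "\<dots> = (\<Sum>j<p. of_nat p * (?L j * ?L j))"
    by (intro sum.cong refl) simp
  also have "\<dots> = of_nat p * (\<Sum>j<p. if j = 0 then 0 else 1)"
    unfolding sum_distrib_left by (intro sum.cong refl) (use L2 in simp)
  finally have e2: "(\<Sum>a<p. gauss_sum p (?w ^ a) * gauss_sum p (?w ^ (a * (p - 1))))
     = of_nat p * (\<Sum>j<p. if j = 0 then 0 else 1)" .
  \<comment> \<open>The common factor, kept as an unevaluated sum, is \<open>p - 1\<close> and can
    be cancelled.\<close>
  have "(\<Sum>j<p. if j = 0 then 0 else 1) * (?L (p - 1) * ?g ^ 2) = (\<Sum>j<p. if j = 0 then 0 else 1) * of_nat p"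
    by (rule trans[OF e1[symmetric]]) (rule trans[OF e2 mult.commute])
  moreover have "(\<Sum>j<p. if j = 0 then 0 else 1 :: complex) \<noteq> 0"
  proof -
    have "{..<p} = insert 0 {1..<p}" using p0 by auto
    hence "(\<Sum>j<p. if j = 0 then 0 else 1 :: complex) = of_nat (p - 1)" using p0 by simp
    thus ?thesis using p by simp
  qed
  ultimately have Lg: "?L (p - 1) * ?g ^ 2 = of_nat p" by (metis mult_cancel_left)
  have "?L (p - 1) * ?L (p - 1) = 1" using L2[of "p - 1"] p by simp
  hence "?g ^ 2 = ?L (p - 1) * of_nat p" by (metis Lg mult.assoc mult_1)
  thus ?thesis unfolding Lm by (simp add: pstar_def)
qed

section \<open>Square roots of -1 and 2, and their product with the Gauss sums\<close>

lemma urt_4: "urt 4 = \<i>"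
  by (simp add: urt_def)

lemma ii_power_odd:
  assumes "odd k" shows "\<i> ^ k = of_int (jac4 (int k)) * \<i>"
proof -
  have "k mod 4 = 1 \<or> k mod 4 = 3" using assms by presburger
  moreover have "int k mod 4 = int (k mod 4)" by (simp add: zmod_int)
  moreover have "\<i> ^ k = \<i> ^ (k mod 4)" by (rule root_pow_mod[symmetric]) simp
  ultimately show ?thesis by (auto simp: jac4_def numeral_3_eq_3)
qed

lemma urt_8_square: "urt 8 ^ 2 = \<i>"
  using urt_pow_div[of 8 2] by (simp add: urt_4)

text \<open>The two squares are \<open>\<i>\<close> and \<open>\<i> ^ 7 = - \<i>\<close> and cancel;
  the cross term is twice \<open>urt 8 ^ 8 = 1\<close>.\<close>

lemma urt_8_sum_square: "(urt 8 + urt 8 ^ 7) ^ 2 = 2"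
proof -
  have "(urt 8 + urt 8 ^ 7) ^ 2 = urt 8 ^ 2 + 2 * (urt 8 ^ 2) ^ 4 + (urt 8 ^ 2) ^ 7"
    by (simp add: power2_sum flip: power_mult power_Suc power_Suc2)
  also have "\<dots> = 2" unfolding urt_8_square by (simp add: eval_nat_numeral)
  finally show ?thesis .
qed

lemma urt_8_sum_odd:
  assumes "odd k"
  shows "urt 8 ^ k + urt 8 ^ (7 * k) = of_int (chi8 (int k)) * (urt 8 + urt 8 ^ 7)"
proof -
  have w8: "urt 8 ^ 8 = 1" by simp
  have "urt 8 ^ 4 = (urt 8 ^ 2) ^ 2" by (simp flip: power_mult)
  hence w4: "urt 8 ^ 4 = -1" unfolding urt_8_square by simp
  define r where "r = k mod 8"
  have r: "r = 1 \<or> r = 3 \<or> r = 5 \<or> r = 7" using assms unfolding r_def by presburger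
  have "int k mod 8 = int r" by (simp add: r_def zmod_int)
  hence chi: "chi8 (int k) = (if r = 1 \<or> r = 7 then 1 else -1)" using r by (auto simp: chi8_def)
  have "urt 8 ^ k = urt 8 ^ r" unfolding r_def by (rule root_pow_mod[OF w8, symmetric])
  moreover have "urt 8 ^ (7 * k) = urt 8 ^ (7 * r mod 8)"
    unfolding r_def by (metis mod_mult_right_eq root_pow_mod[OF w8])
  moreover have "urt 8 ^ 5 = - urt 8" "urt 8 ^ 7 = - (urt 8 ^ 3)"
    using w4 power_add[of "urt 8" 4 1] power_add[of "urt 8" 4 3] by simp_all
  ultimately show ?thesis using r by (auto simp: chi)
qed

definition qchar :: "nat \<Rightarrow> nat \<Rightarrow> nat set \<Rightarrow> nat \<Rightarrow> int" where
  "qchar w0 w S k = chi8 (int k) ^ w0 * jac4 (int k) ^ w * (\<Prod>p\<in>S. Legendre (int k) (int p))"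

lemma cfam_prod:
  assumes "\<And>a b. a \<in> R \<Longrightarrow> b \<in> R \<Longrightarrow> a * b \<in> R" "1 \<in> R" "\<And>i. i \<in> A \<Longrightarrow> F i \<in> cfam R w"
  shows "(\<lambda>k. \<Prod>i\<in>A. F i k) \<in> cfam R w"
  using assms(3)
  by (induction A rule: infinite_finite_induct) (use assms(1,2) in \<open>simp_all add: cfam_const cfam_mult\<close>)

text \<open>Each factor of \<open>Delta\<close> has a square root that is a sum of roots of unity of
  order dividing \<open>n\<close> and that every conjugation multiplies by the matching symbol; both
  properties pass to the product.\<close>

lemma sqrt_Delta_cfam:
  assumes n: "n > 0" and S: "S \<subseteq> {p. prime p \<and> odd p \<and> p dvd n}"
    and w: "w = 0 \<or> 4 dvd n" and w0: "w0 = 0 \<or> 8 dvd n"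
  obtains T where "T \<in> cfam \<int> (urt n)" "T 1 ^ 2 = of_int (Delta w0 w S)"
    "\<And>k. coprime k n \<Longrightarrow> T k = of_int (qchar w0 w S k) * T 1"
proof -
  \<comment> \<open>Powers of \<open>urt n\<close> with exponent a multiple of
    \<open>n div d\<close> are powers of \<open>urt d\<close> only if \<open>d\<close> divides
    \<open>n\<close>. Otherwise \<open>T8\<close> and \<open>T4\<close> are meaningless, but then
    they enter \<open>T\<close> with exponent 0.\<close>
  define T8 where "T8 = (\<lambda>k. 1 * urt n ^ ((n div 8) * k) + 1 * urt n ^ ((7 * (n div 8)) * k))"
  define T4 where "T4 = (\<lambda>k. 1 * urt n ^ ((n div 4) * k))"
  define Tp where "Tp = (\<lambda>p k. \<Sum>j<p. of_int (Legendre (int j) (int p)) * urt n ^ ((n div p * j) * k))"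
  define T where "T = (\<lambda>k. T8 k ^ w0 * T4 k ^ w * (\<Prod>p\<in>S. Tp p k))"
  have div: "urt n ^ (n div d * k) = urt d ^ k" if "d dvd n" for d k
  proof -
    have "n div d dvd n" "n div (n div d) = d" using that n by auto
    thus ?thesis using urt_pow_div[of n "n div d"] n by (simp add: power_mult)
  qed
  have T8: "T8 k = urt 8 ^ k + urt 8 ^ (7 * k)" if "8 dvd n" for k
    using div[OF that, of k] div[OF that, of "7 * k"] by (simp add: T8_def mult_ac)
  have T4: "T4 k = \<i> ^ k" if "4 dvd n" for k
    using div[OF that, of k] by (simp add: T4_def urt_4)
  have Tp: "Tp p k = gauss_sum p (urt p ^ k)" if "p dvd n" for p k
    unfolding Tp_def gauss_sum_def
  proof (intro sum.cong refl)
    fix j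
    show "of_int (Legendre (int j) (int p)) * urt n ^ (n div p * j * k) =
      of_int (Legendre (int j) (int p)) * (urt p ^ k) ^ j"
      using div[OF that, of "j * k"] by (simp add: mult_ac flip: power_mult)
  qed
  have pS: "prime p" "p dvd n" "2 < p" if "p \<in> S" for p
    using that S prime_ge_2_nat[of p] by (auto simp: nat_less_le)
  show ?thesis
  proof (rule that)
    show "T \<in> cfam \<int> (urt n)" unfolding T_def T8_def T4_def Tp_def
      by (intro cfam_mult cfam_power cfam_prod cfam_add cfam_sum cfam_monom) auto
    have "T8 1 ^ 2 = 2" if "8 dvd n" using T8[OF that, of 1] urt_8_sum_square by simp
    moreover have "T4 1 ^ 2 = -1" if "4 dvd n" using T4[OF that, of 1] by simp
    moreover have "Tp p 1 ^ 2 = of_int (pstar p)" if "p \<in> S" for p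
      using Tp[of p 1] gauss_sum_square[of p] pS[OF that] by simp
    ultimately have "(T8 1 ^ 2) ^ w0 = 2 ^ w0" "(T4 1 ^ 2) ^ w = (-1) ^ w"
        "(\<Prod>p\<in>S. Tp p 1 ^ 2) = (\<Prod>p\<in>S. of_int (pstar p))"
      using w w0 by auto
    moreover have "(x ^ m) ^ 2 = (x ^ 2) ^ m" for x :: complex and m
      by (simp add: mult.commute flip: power_mult)
    ultimately show "T 1 ^ 2 = of_int (Delta w0 w S)"
      by (simp add: T_def Delta_def power_mult_distrib prod_power_distrib)
  next
    fix k assume k: "coprime k n"
    have "T8 k ^ w0 = (of_int (chi8 (int k)) * T8 1) ^ w0"
    proof (cases "w0 = 0")
      case False
      hence d: "8 dvd n" using w0 by simp
      hence "odd k" using k coprime_common_divisor[of k n 2] dvd_trans[of 2 _ n] by fastforce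
      thus ?thesis using T8[OF d, of k] T8[OF d, of 1] urt_8_sum_odd by simp
    qed simp
    moreover have "T4 k ^ w = (of_int (jac4 (int k)) * T4 1) ^ w"
    proof (cases "w = 0")
      case False
      hence d: "4 dvd n" using w by simp
      hence "odd k" using k coprime_common_divisor[of k n 2] dvd_trans[of 2 _ n] by fastforce
      thus ?thesis using T4[OF d, of k] T4[OF d, of 1] ii_power_odd by simp
    qed simp
    moreover have "(\<Prod>p\<in>S. Tp p k) = (\<Prod>p\<in>S. of_int (Legendre (int k) (int p)) * Tp p 1)"
    proof (intro prod.cong refl)
      fix p assume p: "p \<in> S"
      have "coprime k p" using k pS(2)[OF p] by (meson coprime_divisors dvd_refl)
      thus "Tp p k = of_int (Legendre (int k) (int p)) * Tp p 1"
        using gauss_sum_power[of p "urt p" k] pS[OF p] Tp[of p k] Tp[of p 1] by simp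
    qed
    ultimately show "T k = of_int (qchar w0 w S k) * T 1"
      by (simp add: T_def qchar_def power_mult_distrib prod.distrib mult_ac)
  qed
qed

section \<open>Characters of finite abelian groups\<close>

lemma gmul_0 [simp]: "gmul 0 g = 0"
  by (simp add: gmul_def)

lemma gmul_Suc [simp]: "gmul (Suc k) g = gmul k g + g"
  by (simp add: gmul_def)

lemma gmul_1 [simp]: "gmul 1 g = g"
  by (simp add: gmul_def)

lemma gmul_add: "gmul (k + l) g = gmul k g + gmul l g"
  by (induction l) (simp_all add: add.assoc)

lemma gmul_mult: "gmul (k * l) g = gmul k (gmul l g)"
  by (induction k) (simp_all add: gmul_add add.commute)

text \<open>Translation by \<open>g\<close> permutes the group, so adding \<open>g\<close> to each
  summand leaves the sum of all elements unchanged.\<close>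

lemma gmul_CARD: "gmul CARD('a) g = (0 :: 'a::{ab_group_add,finite})"
proof -
  have "(\<Sum>x\<in>UNIV. x) = (\<Sum>x\<in>UNIV. x + g)"
    by (rule sum.reindex_bij_betw[symmetric]) (auto simp: bij_plus_right)
  also have "\<dots> = (\<Sum>x\<in>UNIV. x) + (\<Sum>x\<in>(UNIV::'a set). g)" by (rule sum.distrib)
  finally have "(\<Sum>x\<in>(UNIV::'a set). g) = 0" by simp
  moreover have "(\<Sum>x\<in>A. g) = gmul (card A) g" if "finite A" for A :: "'a set"
    using that by induction (simp_all add: add.commute)
  ultimately show ?thesis by simp
qed

lemma group_exponent_props:
  fixes g :: "'a::{ab_group_add,finite}"
  shows "group_exponent TYPE('a) > 0" "gmul (group_exponent TYPE('a)) g = 0"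
proof -
  have "0 < CARD('a) \<and> (\<forall>g::'a. gmul CARD('a) g = 0)" by (simp add: gmul_CARD)
  from LeastI[of "\<lambda>n. 0 < n \<and> (\<forall>g::'a. gmul n g = 0)", OF this]
  show "group_exponent TYPE('a) > 0" "gmul (group_exponent TYPE('a)) g = 0"
    unfolding group_exponent_def by blast+
qed

text \<open>The codomain is all of the complex numbers: on a group of finite exponent these two
  equations already force the values to be roots of unity.\<close>

definition is_char :: "('a::ab_group_add \<Rightarrow> complex) \<Rightarrow> bool" where
  "is_char \<psi> \<longleftrightarrow> \<psi> 0 = 1 \<and> (\<forall>x y. \<psi> (x + y) = \<psi> x * \<psi> y)"

lemma char_gmul: "is_char \<psi> \<Longrightarrow> \<psi> (gmul k g) = \<psi> g ^ k"
  by (induction k) (simp_all add: is_char_def mult.commute)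

lemma gmul_mod:
  assumes "\<And>g::'a::ab_group_add. gmul n g = 0"
  shows "gmul (k mod n) g = gmul k (g::'a)"
proof -
  have "gmul k g = gmul (n * (k div n) + k mod n) g" by simp
  also have "\<dots> = gmul (k mod n) g" by (simp only: gmul_add gmul_mult assms) simp
  finally show ?thesis by simp
qed

lemma gmul_bij:
  fixes n :: nat
  assumes e: "\<And>g::'a::ab_group_add. gmul n g = 0" and k: "coprime k n"
  shows "bij (gmul k :: 'a \<Rightarrow> 'a)"
proof -
  obtain l where l: "[k * l = 1] (mod n)" using cong_solve_coprime_nat[OF k] by auto
  have 1: "gmul (k * l) g = g" for g :: 'a
    using l gmul_mod[OF e, of "k * l" g] gmul_mod[OF e, of 1 g] by (simp add: cong_def)
  hence 2: "gmul (l * k) g = g" for g :: 'a by (simp only: mult.commute[of l k])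
  show ?thesis
  proof (rule o_bij[of "gmul l"])
    show "gmul l \<circ> gmul k = (id :: 'a \<Rightarrow> 'a)" using 2 by (auto simp: fun_eq_iff simp flip: gmul_mult)
    show "gmul k \<circ> gmul l = (id :: 'a \<Rightarrow> 'a)" using 1 by (auto simp: fun_eq_iff simp flip: gmul_mult)
  qed
qed

lemma gmul_uminus_one:
  assumes "\<And>g::'a::ab_group_add. gmul n g = 0" "n > 0"
  shows "gmul (n - 1) g = - (g::'a)"
  using assms gmul_Suc[of "n - 1" g] by (simp add: eq_neg_iff_add_eq_0)

text \<open>Decomposing \<open>v\<close> into eigenfunctions of one translation after the other leaves only
  simultaneous eigenfunctions, which are the multiples of characters.\<close>
lemma char_annihilated_imp_zero_on_eigenfunctions:
  fixes f v :: "'a::{ab_group_add,finite} \<Rightarrow> complex"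
  assumes e: "\<And>g::'a. gmul n g = 0" "n > 0"
    and f: "\<And>\<psi>. is_char \<psi> \<Longrightarrow> (\<Sum>g\<in>UNIV. f g * \<psi> g) = 0"
    and B: "finite B" and v: "\<And>g. g \<notin> B \<Longrightarrow> \<exists>z. \<forall>x. v (x + g) = z * v x"
  shows "(\<Sum>g\<in>UNIV. f g * v g) = 0"
  using B v
proof (induction B arbitrary: v)
  case empty
  obtain z where z: "\<And>g x. v (x + g) = z g * v x" using empty.prems by (metis empty_iff)
  show ?case
  proof (cases "v 0 = 0")
    case True
    hence "v g = 0" for g using z[of 0 g] by simp
    thus ?thesis by simp
  next
    case False
    define \<psi> where "\<psi> = (\<lambda>g. v g / v 0)"
    have \<psi>: "\<psi> g = z g" for g using z[of 0 g] False by (simp add: \<psi>_def)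
    have "\<psi> (x + y) = \<psi> x * \<psi> y" for x y
      using z[of x y] unfolding \<psi>[of y] by (simp add: \<psi>_def)
    hence "is_char \<psi>" using False by (simp add: is_char_def \<psi>_def)
    hence "(\<Sum>g\<in>UNIV. f g * \<psi> g) = 0" by (rule f)
    thus ?thesis using False by (simp add: \<psi>_def flip: sum_divide_distrib)
  qed
next
  case (insert b B)
  let ?w = "inverse (urt n)"
  have wn: "(?w ^ i) ^ n = 1" for i using e(2) by (simp add: power_inverse urt_pow_eq_1_iff flip: power_mult)
  \<comment> \<open>Up to the factor \<open>n\<close>, \<open>V t\<close> is the projection of
    \<open>v\<close> to the functions that translation by \<open>b\<close> multiplies by
    \<open>urt n ^ t\<close>; the projections add up to \<open>n * v\<close>.\<close>
  define V where "V = (\<lambda>t x. (\<Sum>j<n. ?w ^ (t * j) * v (x + gmul j b)))"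
  have V_sum: "(\<Sum>t<n. V t x) = of_nat n * v x" for x
  proof -
    have "(\<Sum>t<n. V t x) = (\<Sum>j<n. \<Sum>t<n. ?w ^ (t * j) * v (x + gmul j b))"
      unfolding V_def by (rule sum.swap)
    also have "\<dots> = (\<Sum>j<n. if j = 0 then of_nat n * v x else 0)"
    proof (intro sum.cong refl)
      fix j assume j: "j \<in> {..<n}"
      have "(\<Sum>t<n. ?w ^ (t * j)) = (\<Sum>t<n. (?w ^ j) ^ t)" by (simp add: mult.commute flip: power_mult)
      also have "\<dots> = (if ?w ^ j = 1 then of_nat n else 0)" by (intro sum_root_of_unity_powers wn)
      also have "?w ^ j = 1 \<longleftrightarrow> j = 0"
        using j e(2) by (auto simp: power_inverse urt_pow_eq_1_iff dest: dvd_imp_le)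
      finally show "(\<Sum>t<n. ?w ^ (t * j) * v (x + gmul j b)) = (if j = 0 then of_nat n * v x else 0)"
        by (simp flip: sum_distrib_right)
    qed
    also have "\<dots> = of_nat n * v x" using e(2) by simp
    finally show ?thesis .
  qed
  have "of_nat n * (\<Sum>g\<in>UNIV. f g * v g) = (\<Sum>g\<in>UNIV. f g * (of_nat n * v g))"
    by (simp add: sum_distrib_left mult_ac)
  also have "\<dots> = (\<Sum>g\<in>UNIV. \<Sum>t<n. f g * V t g)"
    by (simp only: V_sum[symmetric] sum_distrib_left)
  also have "\<dots> = (\<Sum>t<n. \<Sum>g\<in>UNIV. f g * V t g)" by (rule sum.swap)
  also have "\<dots> = 0"
  proof (rule sum.neutral, rule ballI)
    fix t
    show "(\<Sum>g\<in>UNIV. f g * V t g) = 0"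
    proof (rule insert.IH)
      fix g assume g: "g \<notin> B"
      show "\<exists>z. \<forall>x. V t (x + g) = z * V t x"
      proof (cases "g = b")
        case True
        have "V t (x + b) = urt n ^ t * V t x" for x
        proof -
          let ?h = "\<lambda>j. ?w ^ (t * j) * v (x + gmul j b)"
          have "V t (x + b) = (\<Sum>j<n. urt n ^ t * ?h (Suc j))"
            unfolding V_def
          proof (intro sum.cong refl)
            fix j
            have "urt n ^ t * ?w ^ (t * Suc j) = ?w ^ (t * j)"
              by (simp add: power_add power_inverse)
            hence "urt n ^ t * ?h (Suc j) = ?w ^ (t * j) * v (x + gmul (Suc j) b)"
              by (simp only: mult.assoc[symmetric])
            moreover have "x + gmul (Suc j) b = x + b + gmul j b" by (simp add: add_ac)
            ultimately show "?w ^ (t * j) * v (x + b + gmul j b) = urt n ^ t * ?h (Suc j)"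
              by (simp only:)
          qed
          also have "\<dots> = urt n ^ t * (\<Sum>j<n. ?h (Suc j))" by (rule sum_distrib_left[symmetric])
          also have "(\<Sum>j<n. ?h (Suc j)) = (\<Sum>j<n. ?h j) + ?h n - ?h 0"
            using sum.lessThan_Suc_shift[of ?h n] sum.lessThan_Suc[of ?h n] by simp
          also have "?h n = ?h 0" using wn[of t] e(1)[of b] by (simp add: power_mult)
          finally show ?thesis by (simp add: V_def)
        qed
        thus ?thesis using True by blast
      next
        case False
        then obtain z where z: "\<And>x. v (x + g) = z * v x" using g insert.prems by blast
        have "V t (x + g) = z * V t x" for x
          unfolding V_def sum_distrib_left
        proof (intro sum.cong refl)
          fix j
          \<comment> \<open>Translations commute, so the projection keeps the eigenvalues already
            obtained.\<close>
          have "x + g + gmul j b = (x + gmul j b) + g" by (simp add: add_ac)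
          thus "?w ^ (t * j) * v (x + g + gmul j b) = z * (?w ^ (t * j) * v (x + gmul j b))"
            by (simp only: z) simp
        qed
        thus ?thesis by blast
      qed
    qed
  qed
  finally show ?case using e(2) by simp
qed

text \<open>With \<open>B = UNIV\<close> nothing is assumed of \<open>v\<close>, which may thus be
  the indicator function of a single point.\<close>

lemma char_annihilated_imp_zero:
  fixes f :: "'a::{ab_group_add,finite} \<Rightarrow> complex"
  assumes "\<And>\<psi>. is_char \<psi> \<Longrightarrow> (\<Sum>g\<in>UNIV. f g * \<psi> g) = 0"
  shows "f g = 0"
proof -
  have "(\<Sum>h\<in>UNIV. f h * (if h = g then 1 else 0)) = 0"
    using assms char_annihilated_imp_zero_on_eigenfunctions[OF group_exponent_props(2,1), of f UNIV]
    by simp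
  thus ?thesis by (simp add: if_distrib[of "\<lambda>x. _ * x"] cong: if_cong)
qed

section \<open>Eigenvalues as character sums, and their conjugates\<close>

lemma A_set_nth: "A_set C $ u $ v = (if v - u \<in> C then 1 else 0)"
proof -
  have "A_set C $ u $ v = (\<Sum>g\<in>C. if v - u = g then 1 else 0)"
    by (simp add: A_set_def A_elem_def)
  thus ?thesis by simp
qed

definition sgn_ind :: "'a set \<Rightarrow> 'a set \<Rightarrow> 'a \<Rightarrow> int" where
  "sgn_ind C1 C2 g = of_bool (g \<in> C1) - of_bool (g \<in> C2)"

lemma A_diff_mult_vec:
  "((A_set C1 - A_set C2) *v x) $ u = (\<Sum>g\<in>UNIV. of_int (sgn_ind C1 C2 g) * x $ (u + g))"
proof -
  have "((A_set C1 - A_set C2) *v x) $ u = (\<Sum>v\<in>UNIV. of_int (sgn_ind C1 C2 (v - u)) * x $ v)"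
    by (simp add: matrix_vector_mult_def A_set_nth sgn_ind_def of_bool_def if_distrib[of of_int] cong: if_cong)
  also have "\<dots> = (\<Sum>g\<in>UNIV. of_int (sgn_ind C1 C2 (u + g - u)) * x $ (u + g))"
    by (rule sum.reindex_bij_betw[symmetric]) (rule bij_plus)
  finally show ?thesis by simp
qed

text \<open>The matrix commutes with translations, so characters are eigenvectors. Conversely, if
  \<open>c\<close> differs from every character sum, each Fourier coefficient of an eigenvector for
  \<open>c\<close> is 0, because multiplying it by \<open>c\<close> and by the character sum gives
  the same; then the vector itself is 0.\<close>

lemma eigenvalues_A_diff:
  "is_eigenvalue (A_set C1 - A_set C2) c \<longleftrightarrow>
     (\<exists>\<psi>. is_char \<psi> \<and> c = (\<Sum>g\<in>UNIV. of_int (sgn_ind C1 C2 g) * \<psi> g))"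
proof
  let ?f = "\<lambda>g. of_int (sgn_ind C1 C2 g) :: complex"
  assume "\<exists>\<psi>. is_char \<psi> \<and> c = (\<Sum>g\<in>UNIV. ?f g * \<psi> g)"
  then obtain \<psi> where \<psi>: "is_char \<psi>" "c = (\<Sum>g\<in>UNIV. ?f g * \<psi> g)" by blast
  have "(A_set C1 - A_set C2) *v (\<chi> x. \<psi> x) = c *s (\<chi> x. \<psi> x)"
    using \<psi>(1) by (simp add: vec_eq_iff A_diff_mult_vec \<psi>(2) is_char_def sum_distrib_left sum_distrib_right mult_ac)
  moreover have "(\<chi> x. \<psi> x) \<noteq> 0"
    using \<psi>(1) by (auto simp: vec_eq_iff is_char_def intro!: exI[of _ 0])
  ultimately show "is_eigenvalue (A_set C1 - A_set C2) c" unfolding is_eigenvalue_def by blast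
next
  let ?f = "\<lambda>g. of_int (sgn_ind C1 C2 g) :: complex"
  assume "is_eigenvalue (A_set C1 - A_set C2) c"
  then obtain x where x: "x \<noteq> 0" "(A_set C1 - A_set C2) *v x = c *s x"
    unfolding is_eigenvalue_def by blast
  show "\<exists>\<psi>. is_char \<psi> \<and> c = (\<Sum>g\<in>UNIV. ?f g * \<psi> g)"
  proof (rule ccontr)
    assume no: "\<not> ?thesis"
    have "(\<Sum>u\<in>UNIV. x $ (- u) * \<psi> u) = 0" if \<psi>: "is_char \<psi>" for \<psi>
    proof -
      \<comment> \<open>The Fourier coefficient at the inverse character; the substitution of
        \<open>- u\<close> for \<open>u\<close> brings it into the form to which
        \<open>char_annihilated_imp_zero\<close> applies.\<close>
      define X where "X = (\<Sum>u\<in>UNIV. x $ u * \<psi> (- u))"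
      have "c * X = (\<Sum>u\<in>UNIV. (c *s x) $ u * \<psi> (- u))"
        by (simp add: X_def sum_distrib_left mult_ac)
      also have "\<dots> = (\<Sum>u\<in>UNIV. \<Sum>g\<in>UNIV. ?f g * x $ (u + g) * \<psi> (- u))"
        by (simp only: x(2)[symmetric] A_diff_mult_vec sum_distrib_right)
      also have "\<dots> = (\<Sum>g\<in>UNIV. \<Sum>u\<in>UNIV. ?f g * x $ (u + g) * \<psi> (- u))"
        by (rule sum.swap)
      also have "\<dots> = (\<Sum>g\<in>UNIV. ?f g * \<psi> g * X)"
      proof (intro sum.cong refl)
        fix g
        have "(\<Sum>u\<in>UNIV. ?f g * x $ (u + g) * \<psi> (- u)) =
              (\<Sum>u\<in>UNIV. ?f g * \<psi> g * (x $ (u + g) * \<psi> (- (u + g))))"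
        proof (intro sum.cong refl)
          fix u
          have "\<psi> g * \<psi> (- (u + g)) = \<psi> (g + - (u + g))" using \<psi> unfolding is_char_def by metis
          also have "g + - (u + g) = - u" by simp
          finally show "?f g * x $ (u + g) * \<psi> (- u) = ?f g * \<psi> g * (x $ (u + g) * \<psi> (- (u + g)))"
            by (simp add: mult_ac)
        qed
        also have "\<dots> = ?f g * \<psi> g * (\<Sum>u\<in>UNIV. x $ (u + g) * \<psi> (- (u + g)))"
          by (rule sum_distrib_left[symmetric])
        also have "(\<Sum>u\<in>UNIV. x $ (u + g) * \<psi> (- (u + g))) = X"
          unfolding X_def by (rule sum.reindex_bij_betw) (rule bij_plus_right)
        finally show "(\<Sum>u\<in>UNIV. ?f g * x $ (u + g) * \<psi> (- u)) = ?f g * \<psi> g * X" .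
      qed
      also have "\<dots> = (\<Sum>g\<in>UNIV. ?f g * \<psi> g) * X" by (rule sum_distrib_right[symmetric])
      finally have "X = 0" using no \<psi> by auto
      moreover have "X = (\<Sum>u\<in>UNIV. x $ (- u) * \<psi> (- (- u)))"
        unfolding X_def by (rule sum.reindex_bij_betw[symmetric]) (rule bij_uminus)
      ultimately show ?thesis by simp
    qed
    hence "x $ (- u) = 0" for u by (rule char_annihilated_imp_zero)
    hence "x $ u = 0" for u by (metis minus_minus)
    hence "x = 0" by (simp add: vec_eq_iff)
    thus False using x by simp
  qed
qed

lemma char_sum_cfam:
  fixes f :: "'a::{ab_group_add,finite} \<Rightarrow> int"
  assumes e: "\<And>g::'a. gmul n g = 0" "n > 0" and \<psi>: "is_char \<psi>"
  shows "(\<lambda>k. \<Sum>g\<in>UNIV. of_int (f g) * \<psi> g ^ k) \<in> cfam \<int> (urt n)"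
proof -
  have "\<exists>j. \<psi> g = urt n ^ j" for g
  proof -
    have "\<psi> g ^ n = 1" using char_gmul[OF \<psi>, of n g] \<psi> by (simp add: e is_char_def)
    thus ?thesis using urt_roots[OF e(2)] by metis
  qed
  then obtain j where j: "\<And>g. \<psi> g = urt n ^ j g" by metis
  have "(\<lambda>k. \<Sum>g\<in>UNIV. of_int (f g) * urt n ^ (j g * k)) \<in> cfam \<int> (urt n)"
    by (intro cfam_sum cfam_monom) auto
  thus ?thesis by (simp add: j power_mult)
qed

lemma char_sum_reindex:
  fixes f :: "'a::{ab_group_add,finite} \<Rightarrow> int"
  assumes e: "\<And>g::'a. gmul n g = 0" and \<psi>: "is_char \<psi>" and k: "coprime k n"
  shows "(\<Sum>g\<in>UNIV. of_int (f (gmul k g)) * \<psi> g ^ k) = (\<Sum>g\<in>UNIV. of_int (f g) * \<psi> g)"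
  using sum.reindex_bij_betw[OF gmul_bij[OF e k], of "\<lambda>g. of_int (f g) * \<psi> g"]
  by (simp add: char_gmul[OF \<psi>])

text \<open>Substituting \<open>h = gmul k g\<close> makes the left side the character sum of
  \<open>f\<close> transported by the inverse of \<open>k\<close>. Its difference \<open>F\<close>
  from \<open>s * f\<close> is annihilated by all characters.\<close>

lemma char_sums_power_eq_imp:
  fixes f :: "'a::{ab_group_add,finite} \<Rightarrow> int"
  assumes e: "\<And>g::'a. gmul n g = 0" and k: "coprime k n"
    and eq: "\<And>\<psi>. is_char \<psi> \<Longrightarrow>
      (\<Sum>g\<in>UNIV. of_int (f g) * \<psi> g ^ k) = of_int s * (\<Sum>g\<in>UNIV. of_int (f g) * \<psi> g)"
  shows "f g = s * f (gmul k g)"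
proof -
  have bij: "bij (gmul k :: 'a \<Rightarrow> 'a)" by (rule gmul_bij[OF e k])
  define F :: "'a \<Rightarrow> int" where "F h = f (inv_into UNIV (gmul k) h) - s * f h" for h
  have Fk: "F (gmul k g) = f g - s * f (gmul k g)" for g
    using bij by (simp add: F_def bij_is_inj)
  have "(\<Sum>h\<in>UNIV. of_int (F h) * \<psi> h) = 0" if \<psi>: "is_char \<psi>" for \<psi>
  proof -
    have "(\<Sum>h\<in>UNIV. of_int (F h) * \<psi> h) = (\<Sum>g\<in>UNIV. of_int (F (gmul k g)) * \<psi> g ^ k)"
      using char_sum_reindex[OF e \<psi> k, of F] by simp
    also have "\<dots> = (\<Sum>g\<in>UNIV. of_int (f g) * \<psi> g ^ k)
        - of_int s * (\<Sum>g\<in>UNIV. of_int (f (gmul k g)) * \<psi> g ^ k)"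
      by (simp add: Fk algebra_simps sum_subtractf sum_distrib_left)
    also have "\<dots> = 0" using char_sum_reindex[OF e \<psi> k, of f] eq[OF \<psi>] by simp
    finally show ?thesis .
  qed
  hence "(of_int (F (gmul k g)) :: complex) = 0" by (rule char_annihilated_imp_zero)
  hence "F (gmul k g) = 0" by (simp only: of_int_eq_0_iff)
  thus ?thesis unfolding Fk by simp
qed

section \<open>Quadratic fields inside cyclotomic fields\<close>

lemma squarefree_Delta:
  assumes S: "S \<subseteq> {p. prime p \<and> odd p}" and w0: "w0 \<in> {0, 1}"
  shows "squarefree (Delta w0 w S)"
proof -
  have pm: "pstar p = int p \<or> pstar p = - int p" for p
    by (simp add: pstar_def minus_one_power_iff)
  have cop: "coprime (pstar p) (pstar q)" if "p \<in> S" "q \<in> S" "p \<noteq> q" for p q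
  proof -
    have "coprime p q" using that S by (auto intro: primes_coprime)
    hence "coprime (int p) (int q)" by simp
    thus ?thesis using pm[of p] pm[of q] by auto
  qed
  have sqf: "squarefree (pstar p)" if "p \<in> S" for p
  proof -
    have "prime (int p)" using that S by auto
    hence "squarefree (int p)" by (rule squarefree_prime)
    thus ?thesis using pm[of p] by auto
  qed
  have c2: "coprime 2 (pstar p)" if "p \<in> S" for p
  proof -
    have "odd (int p)" using that S by auto
    hence "coprime 2 (int p)" by simp
    thus ?thesis using pm[of p] by auto
  qed
  have "squarefree (2 ^ w0 * (\<Prod>p\<in>S. pstar p))"
  proof (rule squarefree_mult_coprime)
    show "coprime (2 ^ w0) (\<Prod>p\<in>S. pstar p)"
      using c2 by (intro prod_coprime_right) simp
    show "squarefree (2 ^ w0 :: int)" using w0 squarefree_prime[of "2::int"] by auto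
    show "squarefree (\<Prod>p\<in>S. pstar p)" using cop sqf by (rule squarefree_prod_coprime)
  qed
  moreover have "Delta w0 w S = 2 ^ w0 * (\<Prod>p\<in>S. pstar p) \<or> Delta w0 w S = - (2 ^ w0 * (\<Prod>p\<in>S. pstar p))"
    by (simp add: Delta_def minus_one_power_iff)
  ultimately show ?thesis by (metis squarefree_minus)
qed

text \<open>In lowest terms \<open>b = r / s\<close>, the square \<open>s ^ 2\<close> divides
  \<open>r ^ 2 * D\<close> and is coprime to \<open>r ^ 2\<close>, so it divides the squarefree
  \<open>D\<close>.\<close>

lemma rat_square_times_squarefree_int:
  fixes b :: complex and D :: int
  assumes D: "squarefree D" and b: "b \<in> \<rat>" and z: "b ^ 2 * of_int D \<in> \<int>"
  shows "b \<in> \<int>"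
proof -
  obtain q where q: "b = of_rat q" using b by (auto elim: Rats_cases)
  obtain r s where rs: "quotient_of q = (r, s)" by (cases "quotient_of q") auto
  have s: "s > 0" "coprime r s" using rs quotient_of_denom_pos quotient_of_coprime by blast+
  have "q = of_int r / of_int s" using quotient_of_div[OF rs] .
  hence b_eq: "b = of_int r / of_int s" by (simp add: q of_rat_divide)
  obtain m where "b ^ 2 * of_int D = of_int m" using z by (auto elim: Ints_cases)
  hence "of_int (r ^ 2 * D) = (of_int (m * s ^ 2) :: complex)"
    using s by (simp add: b_eq field_simps)
  hence "r ^ 2 * D = m * s ^ 2" by (simp only: of_int_eq_iff)
  hence "s ^ 2 dvd r ^ 2 * D" by simp
  moreover have "coprime (s ^ 2) (r ^ 2)" using s by (simp add: coprime_commute)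
  ultimately have "s ^ 2 dvd D" by (simp add: coprime_dvd_mult_right_iff)
  hence "s dvd 1" using D squarefreeD by blast
  hence "s = 1" using s by simp
  thus ?thesis by (simp add: b_eq)
qed

lemma qchar_values:
  assumes S: "S \<subseteq> {p. prime p \<and> odd p \<and> p dvd n}"
    and w: "w = 0 \<or> 4 dvd n" and w0: "w0 = 0 \<or> 8 dvd n" and k: "coprime k n"
  shows "qchar w0 w S k \<in> {1, -1}"
proof -
  have odd: "odd k" if "even n" using k that coprime_common_divisor[of k n 2] by auto
  have "\<bar>chi8 (int k) ^ w0\<bar> = 1"
  proof (cases "w0 = 0")
    case False
    hence "odd k" using w0 odd by auto
    hence "int k mod 8 = 1 \<or> int k mod 8 = 3 \<or> int k mod 8 = 5 \<or> int k mod 8 = 7" by presburger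
    thus ?thesis by (auto simp: chi8_def power_abs)
  qed simp
  moreover have "\<bar>jac4 (int k) ^ w\<bar> = 1"
  proof (cases "w = 0")
    case False
    hence "odd k" using w odd by auto
    hence "int k mod 4 = 1 \<or> int k mod 4 = 3" by presburger
    thus ?thesis by (auto simp: jac4_def power_abs)
  qed simp
  moreover have "\<bar>\<Prod>p\<in>S. Legendre (int k) (int p)\<bar> = 1"
    unfolding abs_prod
  proof (rule prod.neutral, rule ballI)
    fix p assume p: "p \<in> S"
    have "\<not> p dvd k"
    proof
      assume "p dvd k"
      hence "is_unit p" using k p S coprime_common_divisor[of k n p] by auto
      thus False using p S by auto
    qed
    hence "Legendre (int k) (int p) \<in> {1, -1}" by (intro Legendre_values) simp
    thus "\<bar>Legendre (int k) (int p)\<bar> = 1" by auto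
  qed
  ultimately have "\<bar>qchar w0 w S k\<bar> = 1" by (simp add: qchar_def abs_mult)
  thus ?thesis by (auto simp: abs_if split: if_splits)
qed

lemma cfam_rescale: "F \<in> cfam R w \<Longrightarrow> (\<lambda>k. F (k * l)) \<in> cfam R w"
proof (induction rule: cfam.induct)
  case (step F c j)
  from cfam.step[OF step.IH step.hyps(2), of "j * l"] show ?case by (simp add: mult_ac)
qed (simp add: cfam.zero)

text \<open>The index \<open>n - 1\<close> stands for -1, and inverting a root of unity is complex
  conjugation; integral coefficients are real.\<close>

lemma cfam_cnj:
  assumes n: "n > 0" and F: "F \<in> cfam \<int> (urt n)"
  shows "F (n - 1) = cnj (F 1)"
  using F
proof induction
  case (step F c j)
  have "cnj c = c" using step.hyps(2) by (auto elim!: Ints_cases)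
  moreover have "urt n ^ (n - 1) = cnj (urt n)"
    using urt_inverse_power[OF n, of 1] n by (simp add: urt_def cis_cnj)
  hence "urt n ^ (j * (n - 1)) = cnj (urt n ^ j)" by (simp add: mult.commute[of j] power_mult)
  ultimately show ?case using step.IH by simp
qed simp

text \<open>All that is kept of the Gauss sums is a cyclotomic integer \<open>T 1\<close> with
  square \<Delta>, together with its conjugates; the explicit symbols reappear only in
  \<open>H_iff\<close>.\<close>

locale quadratic_setup =
  fixes n w0 w :: nat and S :: "nat set" and T :: "nat \<Rightarrow> complex"
  assumes n: "n > 0"
    and sqf: "squarefree (Delta w0 w S)"
    and X_values: "coprime k n \<Longrightarrow> qchar w0 w S k \<in> {1, -1}"
    and T_cfam: "T \<in> cfam \<int> (urt n)"
    and T1_square: "T 1 ^ 2 = of_int (Delta w0 w S)"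
    and T_coprime: "coprime k n \<Longrightarrow> T k = of_int (qchar w0 w S k) * T 1"
begin

abbreviation "D \<equiv> Delta w0 w S"
abbreviation "X \<equiv> qchar w0 w S"
abbreviation "H \<equiv> H_Delta n w0 w S"
abbreviation "U \<equiv> units_mod n"

lemma H_iff: "k \<in> H \<longleftrightarrow> k \<in> U \<and> X k = 1"
  by (simp add: H_Delta_def qchar_def)

lemma U_coprime: "k \<in> U \<Longrightarrow> coprime k n"
  by (simp add: units_mod_def)

lemma finite_U: "finite U"
  by (rule finite_subset[of _ "{..<n}"]) (auto simp: units_mod_def)

lemma D_nz: "D \<noteq> 0"
  using sqf by auto

lemma T1_nz: "T 1 \<noteq> 0"
  using T1_square D_nz by auto

lemma T_cfam_Rats: "T \<in> cfam \<rat> (urt n)"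
  by (rule cfam_Ints_Rats[OF T_cfam])

lemma T1_eq: "csqrt (of_int D) = T 1 \<or> csqrt (of_int D) = - T 1"
proof -
  have "csqrt (of_int D) ^ 2 = T 1 ^ 2" by (simp only: T1_square power2_csqrt)
  thus ?thesis by (simp only: power2_eq_iff)
qed

lemma Q_sqrt_iff: "c \<in> Q_sqrt D \<longleftrightarrow> (\<exists>a b. a \<in> \<rat> \<and> b \<in> \<rat> \<and> c = a + b * T 1)"
proof
  assume "c \<in> Q_sqrt D"
  then obtain a b :: real where ab: "a \<in> \<rat>" "b \<in> \<rat>" "c = of_real a + of_real b * csqrt (of_int D)"
    by (auto simp: Q_sqrt_def)
  have "c = of_real a + of_real b * T 1 \<or> c = of_real a + (- of_real b) * T 1"
    using T1_eq ab(3) by auto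
  moreover have "complex_of_real a \<in> \<rat>" "complex_of_real b \<in> \<rat>" using ab by (auto elim!: Rats_cases)
  ultimately show "\<exists>a b. a \<in> \<rat> \<and> b \<in> \<rat> \<and> c = a + b * T 1"
    using Rats_minus_iff by blast
next
  assume "\<exists>a b. a \<in> \<rat> \<and> b \<in> \<rat> \<and> c = a + b * T 1"
  then obtain a b where ab: "a \<in> \<rat>" "b \<in> \<rat>" "c = a + b * T 1" by blast
  obtain p q where pq: "a = of_rat p" "b = of_rat q" using ab by (auto elim!: Rats_cases)
  have "of_rat r = complex_of_real (of_rat r)" for r by (cases r) (simp add: of_rat_rat)
  hence c: "c = of_real (of_rat p) + of_real (of_rat q) * T 1" using ab pq by simp
  from T1_eq show "c \<in> Q_sqrt D"
  proof
    assume "csqrt (of_int D) = T 1"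
    hence "c = of_real (of_rat p) + of_real (of_rat q) * csqrt (of_int D)" using c by simp
    thus ?thesis unfolding Q_sqrt_def using Rats_of_rat by blast
  next
    assume "csqrt (of_int D) = - T 1"
    hence "c = of_real (of_rat p) + of_real (of_rat (- q)) * csqrt (of_int D)"
      using c by (simp add: of_rat_minus)
    thus ?thesis unfolding Q_sqrt_def using Rats_of_rat by blast
  qed
qed

lemma int_mult_sqrt_iff: "c \<in> int_mult_sqrt D \<longleftrightarrow> (\<exists>z. c = of_int z * T 1)"
proof -
  have "c = of_int z * - T 1 \<longleftrightarrow> c = of_int (- z) * T 1" for z by simp
  hence "(\<exists>z. c = of_int z * - T 1) \<longleftrightarrow> (\<exists>z. c = of_int z * T 1)"
    by (metis minus_minus)
  moreover have "c \<in> int_mult_sqrt D \<longleftrightarrow> (\<exists>z. c = of_int z * csqrt (of_int D))"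
    by (auto simp: int_mult_sqrt_def)
  ultimately show ?thesis using T1_eq by (elim disjE) (simp_all only:)
qed

text \<open>The family \<open>F - a - b * T\<close> has rational coefficients and vanishes at 1,
  hence at \<open>k\<close>.\<close>

lemma galois_conjugate:
  assumes F: "F \<in> cfam \<rat> (urt n)" and F1: "F 1 = a + b * T 1" "a \<in> \<rat>" "b \<in> \<rat>" and k: "coprime k n"
  shows "F k = a + b * of_int (X k) * T 1"
proof -
  have "(\<lambda>k. F k + (-a + (-b) * T k)) \<in> cfam \<rat> (urt n)"
    using F F1 T_cfam_Rats by (intro cfam_add cfam_mult cfam_const) auto
  moreover have "F 1 + (-a + (-b) * T 1) = 0" by (simp only: F1) simp
  ultimately have "F k + (-a + (-b) * T k) = 0" using cfam_vanish_coprime[OF n _ _ k] by blast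
  thus ?thesis using T_coprime[OF k] by (simp add: algebra_simps)
qed

text \<open>\<open>U\<close> and \<open>totatives n\<close> differ only for \<open>n = 1\<close>,
  where the single class is represented by 0 and by 1 respectively.\<close>

lemma trace_rat:
  assumes F: "F \<in> cfam \<rat> (urt n)" shows "(\<Sum>k\<in>U. F k) \<in> \<rat>"
proof (cases "n = 1")
  case True
  hence "U = {0}" "totatives n = {1}" by (auto simp: units_mod_def)
  moreover have "F 0 = F 1" using cfam_cong[OF n F, of 0 1] True by simp
  ultimately show ?thesis using cfam_trace_rat[OF n F] by simp
next
  case False
  hence "U = totatives n" using n by (auto simp: units_mod_def in_totatives_iff le_less intro!: gr0I)
  thus ?thesis using cfam_trace_rat[OF n F] by simp
qed

lemma X_cong: assumes "[k = l] (mod n)" "coprime k n" shows "X k = X l"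
proof -
  have "coprime l n" using assms cong_imp_coprime by blast
  hence "of_int (X k) * T 1 = of_int (X l) * T 1"
    using cfam_cong[OF n T_cfam assms(1)] T_coprime assms(2) by metis
  thus ?thesis using T1_nz by simp
qed

lemma X_mult: assumes "coprime k n" "coprime l n" shows "X (k * l) = X k * X l"
proof -
  have "(\<lambda>k. T (k * l)) \<in> cfam \<rat> (urt n)" by (intro cfam_rescale T_cfam_Rats)
  from galois_conjugate[OF this, of 0 "of_int (X l)" k] assms T_coprime[of l]
  have "T (k * l) = of_int (X l) * of_int (X k) * T 1" by simp
  moreover have "T (k * l) = of_int (X (k * l)) * T 1" using assms by (intro T_coprime) simp
  ultimately have "of_int (X (k * l)) = (of_int (X l * X k) :: complex)" using T1_nz by simp
  hence "X (k * l) = X l * X k" by (simp only: of_int_eq_iff)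
  thus ?thesis by simp
qed

lemma mod_in_U: "coprime k n \<Longrightarrow> k mod n \<in> U"
  using n by (simp add: units_mod_def coprime_mod_left_iff)

lemma X_mod: "coprime k n \<Longrightarrow> X (k mod n) = X k"
  by (rule sym, rule X_cong) (simp_all add: cong_def)

lemma one_mod_in_H: "1 mod n \<in> H"
proof -
  have "X 1 * X 1 = X 1" using X_mult[of 1 1] by simp
  moreover have "X 1 \<in> {1, -1}" by (rule X_values) simp
  ultimately have "X 1 = 1" by auto
  thus ?thesis using mod_in_U[of 1] X_mod[of 1] by (simp add: H_iff)
qed

text \<open>The trace of \<open>F\<close> and the trace of \<open>F T\<close> divided by \<open>T 1\<close> add up to a multiple of \<open>F 1\<close>.\<close>
lemma H_fixed_imp_quadratic:
  assumes F: "F \<in> cfam \<rat> (urt n)" and inv: "\<And>k. k \<in> H \<Longrightarrow> F k = F 1"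
  shows "\<exists>a b. a \<in> \<rat> \<and> b \<in> \<rat> \<and> F 1 = a + b * T 1"
proof -
  define \<alpha> \<beta> where "\<alpha> = (\<Sum>k\<in>U. F k)" and "\<beta> = (\<Sum>k\<in>U. F k * T k)"
  have \<alpha>: "\<alpha> \<in> \<rat>" unfolding \<alpha>_def by (rule trace_rat[OF F])
  have \<beta>: "\<beta> \<in> \<rat>" unfolding \<beta>_def
    using F T_cfam_Rats by (intro trace_rat cfam_mult) auto
  have "finite H" using finite_U by (rule rev_finite_subset) (auto simp: H_iff)
  hence h0: "card H \<noteq> 0" using one_mod_in_H by auto
  have "\<beta> / T 1 = (\<Sum>k\<in>U. F k * of_int (X k))"
    unfolding \<beta>_def sum_divide_distrib
  proof (intro sum.cong refl)
    fix k assume "k \<in> U"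
    hence "T k = of_int (X k) * T 1" by (intro T_coprime U_coprime)
    thus "F k * T k / T 1 = F k * of_int (X k)" using T1_nz by simp
  qed
  \<comment> \<open>The weight \<open>1 + X k\<close> is 2 on \<open>H\<close> and 0 on the other
    coset, so only the conjugates equal to \<open>F 1\<close> survive.\<close>
  hence "\<alpha> + \<beta> / T 1 = (\<Sum>k\<in>U. F k + F k * of_int (X k))"
    by (simp add: \<alpha>_def sum.distrib)
  also have "\<dots> = (\<Sum>k\<in>U. if k \<in> H then 2 * F 1 else 0)"
  proof (intro sum.cong refl)
    fix k assume k: "k \<in> U"
    show "F k + F k * of_int (X k) = (if k \<in> H then 2 * F 1 else 0)"
      using X_values[OF U_coprime[OF k]] inv[of k] k by (auto simp: H_iff)
  qed
  also have "\<dots> = (\<Sum>k\<in>H. 2 * F 1)"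
    using finite_U by (intro sum.mono_neutral_cong_right) (auto simp: H_iff)
  also have "\<dots> = of_nat (card H) * (2 * F 1)" by simp
  finally have "\<alpha> + \<beta> / T 1 = of_nat (card H) * (2 * F 1)" .
  \<comment> \<open>Since \<open>T 1\<close> squares to \<open>D\<close>, its inverse is
    \<open>T 1 / D\<close>, a rational multiple of \<open>T 1\<close>.\<close>
  moreover have "\<beta> / T 1 = \<beta> / of_int D * T 1"
    using T1_square[symmetric] T1_nz by (simp add: power2_eq_square)
  ultimately have eq: "\<alpha> + \<beta> / of_int D * T 1 = of_nat (card H) * (2 * F 1)" by (simp only:)
  have "(\<alpha> + \<beta> / of_int D * T 1) / (2 * of_nat (card H)) = F 1"
    unfolding eq using h0 by simp
  hence "F 1 = \<alpha> / (2 * of_nat (card H)) + \<beta> / of_int D / (2 * of_nat (card H)) * T 1"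
    by (simp add: add_divide_distrib)
  moreover have "\<alpha> / (2 * of_nat (card H)) \<in> \<rat>" "\<beta> / of_int D / (2 * of_nat (card H)) \<in> \<rat>"
    using \<alpha> \<beta> by auto
  ultimately show ?thesis by blast
qed

lemma T1_rat_imp_D_eq_1:
  assumes "T 1 \<in> \<rat>" shows "D = 1"
proof -
  obtain z where z: "T 1 = of_int z" using cfam_rational_imp_int[OF n T_cfam assms] by (auto elim: Ints_cases)
  hence "of_int (z ^ 2) = (of_int D :: complex)" using T1_square by simp
  hence "z ^ 2 = D" by (simp only: of_int_eq_iff)
  moreover from this have "z dvd 1" using sqf squarefreeD[of D z] by simp
  hence "\<bar>z\<bar> = 1" by simp
  hence "z ^ 2 = 1" by (metis one_power2 power2_abs)
  ultimately show ?thesis by simp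
qed

text \<open>If \<open>H\<close> were all of \<open>U\<close>, every conjugate of \<open>T 1\<close>
  would equal \<open>T 1\<close>, and its rational trace would make it rational, which forces
  \<open>D = 1\<close>.\<close>

lemma nontrivial_coset:
  assumes "D \<noteq> 1" obtains k where "k \<in> U - H"
proof -
  have "\<exists>k. k \<in> U - H"
  proof (rule ccontr)
    assume "\<not> ?thesis"
    hence "T k = T 1" if "k \<in> U" for k using that T_coprime[of k] U_coprime[of k] by (auto simp: H_iff)
    hence "(\<Sum>k\<in>U. T k) = of_nat (card U) * T 1" by simp
    moreover have "(\<Sum>k\<in>U. T k) \<in> \<rat>" by (intro trace_rat T_cfam_Rats)
    moreover have "card U \<noteq> 0" using finite_U one_mod_in_H by (auto simp: H_iff)
    ultimately have "T 1 = (\<Sum>k\<in>U. T k) / of_nat (card U)" by simp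
    hence "T 1 \<in> \<rat>" using \<open>(\<Sum>k\<in>U. T k) \<in> \<rat>\<close> by simp
    thus False using T1_rat_imp_D_eq_1 assms by blast
  qed
  thus ?thesis using that by blast
qed

text \<open>Here \<open>T 1\<close> is 1 or -1, hence equal to all its conjugates, so the character
  is trivial; no inspection of the parameters is involved.\<close>

lemma D_eq_1_imp_H: assumes "D = 1" shows "H = U"
proof -
  have "T 1 \<in> {1, -1}" using T1_square assms by (simp add: power2_eq_1_iff)
  hence T1: "T 1 \<in> \<rat>" by auto
  have "X k = 1" if k: "k \<in> U" for k
  proof -
    have "T k = T 1 + 0 * of_int (X k) * T 1"
      using T1 by (intro galois_conjugate T_cfam_Rats U_coprime k) auto
    thus ?thesis using T_coprime[OF U_coprime[OF k]] T1_nz by simp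
  qed
  thus ?thesis by (auto simp: H_iff)
qed

text \<open>Conjugation by \<open>n - 1\<close> is complex conjugation, and a square root of
  \<open>D\<close> is real or purely imaginary according to the sign of \<open>D\<close>.\<close>

lemma X_minus_one:
  shows "D < 0 \<Longrightarrow> X (n - 1) = -1" and "D > 0 \<Longrightarrow> X (n - 1) = 1"
proof -
  have "coprime (n - 1) n" using n by (rule coprime_diff_one_left_nat)
  hence eq: "cnj (T 1) = of_int (X (n - 1)) * T 1" "X (n - 1) \<in> {1, -1}"
    using T_coprime[of "n - 1"] cfam_cnj[OF n T_cfam] X_values by auto
  have re: "Re (T 1) ^ 2 - Im (T 1) ^ 2 = of_int D"
  proof -
    have "Re (T 1 ^ 2) = of_int D" unfolding T1_square by simp
    thus ?thesis by (simp add: power2_eq_square)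
  qed
  show "X (n - 1) = -1" if "D < 0"
  proof (rule ccontr)
    assume "X (n - 1) \<noteq> -1"
    hence "cnj (T 1) = T 1" using eq by auto
    hence "Im (T 1) = 0" by (metis Reals_cnj_iff complex_is_Real_iff)
    hence "of_int D \<ge> (0::real)" using re by (metis diff_zero power_zero_numeral zero_le_power2)
    thus False using that by simp
  qed
  show "X (n - 1) = 1" if "D > 0"
  proof (rule ccontr)
    assume "X (n - 1) \<noteq> 1"
    hence "cnj (T 1) = - T 1" using eq by auto
    hence "Re (cnj (T 1)) = Re (- T 1)" by simp
    hence "Re (T 1) = 0" by simp
    hence "of_int D \<le> (0::real)" using re by (metis diff_0 neg_le_0_iff_le power_zero_numeral zero_le_power2)
    thus False using that by simp
  qed
qed

end

section \<open>From eigenvalues to the symmetry of the two sets\<close>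

lemma union_of_classes_iff: "union_of_classes K C \<longleftrightarrow> (\<forall>k\<in>K. \<forall>h. gmul k h \<in> C \<longleftrightarrow> h \<in> C)"
  unfolding union_of_classes_def equivH_def by blast

locale quadratic_cayley = quadratic_setup n w0 w S T for n w0 w S T +
  fixes C1 C2 :: "'a::{ab_group_add,finite} set"
  assumes e: "\<And>g::'a. gmul n g = 0" and disj: "C1 \<inter> C2 = {}"
begin

abbreviation "f \<equiv> sgn_ind C1 C2"

text \<open>Disjointness lets the values 1, -1 and 0 tell \<open>C1\<close>, \<open>C2\<close> and
  the rest apart, so conditions on two sets become conditions on one function.\<close>

lemma f_cases: "f g = f h \<longleftrightarrow> (g \<in> C1 \<longleftrightarrow> h \<in> C1) \<and> (g \<in> C2 \<longleftrightarrow> h \<in> C2)"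
  using disj by (auto simp: sgn_ind_def of_bool_def)

lemma f_neg: "f g = - f h \<longleftrightarrow> (g \<in> C1 \<longleftrightarrow> h \<in> C2) \<and> (g \<in> C2 \<longleftrightarrow> h \<in> C1)"
  using disj by (auto simp: sgn_ind_def of_bool_def)

lemma unions_iff:
  "union_of_classes H C1 \<and> union_of_classes H C2 \<longleftrightarrow> (\<forall>k\<in>H. \<forall>g. f (gmul k g) = f g)"
  unfolding union_of_classes_iff f_cases by blast

text \<open>The conjugate by \<open>k\<close> of the eigenvalue
  \<open>\<theta> \<psi> 1\<close>.\<close>

definition "\<theta> \<psi> k = (\<Sum>g\<in>UNIV. of_int (f g) * \<psi> g ^ k)"

lemma theta_cfam: "is_char \<psi> \<Longrightarrow> \<theta> \<psi> \<in> cfam \<int> (urt n)"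
  unfolding \<theta>_def[abs_def] using char_sum_cfam[OF e n] by simp

lemma theta_1: "\<theta> \<psi> 1 = (\<Sum>g\<in>UNIV. of_int (f g) * \<psi> g)"
  by (simp add: \<theta>_def)

lemma theta_scale:
  assumes \<psi>: "is_char \<psi>" and k: "coprime k n" and f: "\<And>g. f (gmul k g) = s * f g"
  shows "of_int s * \<theta> \<psi> k = \<theta> \<psi> 1"
  using char_sum_reindex[OF e \<psi> k, of f]
  by (simp add: theta_1 f) (simp add: \<theta>_def sum_distrib_left mult_ac)

lemma quadratic_iff:
  "(\<forall>\<psi>. is_char \<psi> \<longrightarrow> \<theta> \<psi> 1 \<in> Q_sqrt D) \<longleftrightarrow> (\<forall>k\<in>H. \<forall>g. f (gmul k g) = f g)"
proof
  assume L: "\<forall>\<psi>. is_char \<psi> \<longrightarrow> \<theta> \<psi> 1 \<in> Q_sqrt D"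
  show "\<forall>k\<in>H. \<forall>g. f (gmul k g) = f g"
  proof (intro ballI allI)
    fix k g assume k: "k \<in> H"
    hence cop: "coprime k n" using U_coprime by (simp add: H_iff)
    have "f g = 1 * f (gmul k g)"
    proof (rule char_sums_power_eq_imp[OF e cop])
      fix \<psi> :: "'a \<Rightarrow> complex" assume \<psi>: "is_char \<psi>"
      obtain a b where ab: "a \<in> \<rat>" "b \<in> \<rat>" "\<theta> \<psi> 1 = a + b * T 1" using L \<psi> Q_sqrt_iff by blast
      have "\<theta> \<psi> k = a + b * of_int (X k) * T 1"
        using ab cop by (intro galois_conjugate cfam_Ints_Rats theta_cfam \<psi>) auto
      hence "\<theta> \<psi> k = of_int 1 * \<theta> \<psi> 1" using k ab by (simp add: H_iff)
      thus "(\<Sum>g\<in>UNIV. of_int (f g) * \<psi> g ^ k) = of_int 1 * (\<Sum>g\<in>UNIV. of_int (f g) * \<psi> g)"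
        unfolding theta_1 unfolding \<theta>_def .
    qed
    thus "f (gmul k g) = f g" by simp
  qed
next
  assume R: "\<forall>k\<in>H. \<forall>g. f (gmul k g) = f g"
  show "\<forall>\<psi>. is_char \<psi> \<longrightarrow> \<theta> \<psi> 1 \<in> Q_sqrt D"
  proof (intro allI impI)
    fix \<psi> :: "'a \<Rightarrow> complex" assume \<psi>: "is_char \<psi>"
    have "\<theta> \<psi> k = \<theta> \<psi> 1" if "k \<in> H" for k
      using theta_scale[OF \<psi>, of k 1] that U_coprime R by (simp add: H_iff)
    thus "\<theta> \<psi> 1 \<in> Q_sqrt D" unfolding Q_sqrt_iff
      by (intro H_fixed_imp_quadratic cfam_Ints_Rats theta_cfam \<psi>)
  qed
qed

lemma integral_iff_D_eq_1:
  assumes "D = 1"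
  shows "(\<forall>\<psi>. is_char \<psi> \<longrightarrow> \<theta> \<psi> 1 \<in> int_mult_sqrt D) \<longleftrightarrow> (\<forall>k\<in>H. \<forall>g. f (gmul k g) = f g)"
proof -
  have "\<theta> \<psi> 1 \<in> int_mult_sqrt D \<longleftrightarrow> \<theta> \<psi> 1 \<in> Q_sqrt D" if \<psi>: "is_char \<psi>" for \<psi> :: "'a \<Rightarrow> complex"
  proof
    assume "\<theta> \<psi> 1 \<in> int_mult_sqrt D"
    then obtain z where "\<theta> \<psi> 1 = 0 + of_int z * T 1" using int_mult_sqrt_iff by auto
    thus "\<theta> \<psi> 1 \<in> Q_sqrt D" unfolding Q_sqrt_iff using Rats_0 Rats_of_int by blast
  next
    have sq: "csqrt (of_int D) = 1" by (simp add: assms)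
    assume "\<theta> \<psi> 1 \<in> Q_sqrt D"
    then obtain a b :: real where "a \<in> \<rat>" "b \<in> \<rat>" "\<theta> \<psi> 1 = of_real a + of_real b"
      unfolding Q_sqrt_def sq by auto
    hence "\<theta> \<psi> 1 \<in> \<rat>" by (auto elim!: Rats_cases)
    \<comment> \<open>Here Q(sqrt \<Delta>) is the field of rationals, and a rational character sum
      is an integer.\<close>
    hence "\<theta> \<psi> 1 \<in> \<int>" by (rule cfam_rational_imp_int[OF n theta_cfam[OF \<psi>]])
    thus "\<theta> \<psi> 1 \<in> int_mult_sqrt D" unfolding int_mult_sqrt_def sq by (auto elim: Ints_cases)
  qed
  thus ?thesis using quadratic_iff by blast
qed

lemma integral_iff_D_neq_1:
  assumes D: "D \<noteq> 1"
  shows "(\<forall>\<psi>. is_char \<psi> \<longrightarrow> \<theta> \<psi> 1 \<in> int_mult_sqrt D) \<longleftrightarrow>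
    (\<forall>k\<in>H. \<forall>g. f (gmul k g) = f g) \<and> (\<exists>k\<in>U - H. \<forall>g. f (gmul k g) = - f g)"
proof
  assume L: "\<forall>\<psi>. is_char \<psi> \<longrightarrow> \<theta> \<psi> 1 \<in> int_mult_sqrt D"
  have z: "\<exists>z. \<theta> \<psi> 1 = 0 + of_int z * T 1" if "is_char \<psi>" for \<psi> :: "'a \<Rightarrow> complex"
    using L that int_mult_sqrt_iff by auto
  have "\<theta> \<psi> 1 \<in> Q_sqrt D" if "is_char \<psi>" for \<psi> :: "'a \<Rightarrow> complex"
    unfolding Q_sqrt_iff using z[OF that] Rats_0 Rats_of_int by blast
  hence 1: "\<forall>k\<in>H. \<forall>g. f (gmul k g) = f g" using quadratic_iff by blast
  obtain k where k: "k \<in> U - H" using nontrivial_coset[OF D] .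
  hence cop: "coprime k n" using U_coprime by blast
  have X: "X k = -1" using k X_values[OF cop] by (auto simp: H_iff)
  have "f (gmul k g) = - f g" for g
  proof -
    have "f g = (-1) * f (gmul k g)"
    proof (rule char_sums_power_eq_imp[OF e cop])
      fix \<psi> :: "'a \<Rightarrow> complex" assume \<psi>: "is_char \<psi>"
      obtain z where z: "\<theta> \<psi> 1 = 0 + of_int z * T 1" using z[OF \<psi>] by blast
      have "\<theta> \<psi> k = 0 + of_int z * of_int (X k) * T 1"
        using z cop by (intro galois_conjugate cfam_Ints_Rats theta_cfam \<psi>) auto
      hence "\<theta> \<psi> k = of_int (-1) * \<theta> \<psi> 1" using z X by simp
      thus "(\<Sum>g\<in>UNIV. of_int (f g) * \<psi> g ^ k) = of_int (-1) * (\<Sum>g\<in>UNIV. of_int (f g) * \<psi> g)"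
        unfolding theta_1 unfolding \<theta>_def .
    qed
    thus ?thesis by simp
  qed
  thus "(\<forall>k\<in>H. \<forall>g. f (gmul k g) = f g) \<and> (\<exists>k\<in>U - H. \<forall>g. f (gmul k g) = - f g)" using 1 k by blast
next
  assume R: "(\<forall>k\<in>H. \<forall>g. f (gmul k g) = f g) \<and> (\<exists>k\<in>U - H. \<forall>g. f (gmul k g) = - f g)"
  then obtain k where k: "k \<in> U - H" "\<And>g. f (gmul k g) = - f g" by blast
  hence cop: "coprime k n" using U_coprime by blast
  have X: "X k = -1" using k X_values[OF cop] by (auto simp: H_iff)
  show "\<forall>\<psi>. is_char \<psi> \<longrightarrow> \<theta> \<psi> 1 \<in> int_mult_sqrt D"
  proof (intro allI impI)
    fix \<psi> :: "'a \<Rightarrow> complex" assume \<psi>: "is_char \<psi>"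
    have "\<theta> \<psi> 1 \<in> Q_sqrt D" using quadratic_iff R \<psi> by blast
    then obtain a b where ab: "a \<in> \<rat>" "b \<in> \<rat>" "\<theta> \<psi> 1 = a + b * T 1" using Q_sqrt_iff by blast
    have "\<theta> \<psi> k = a + b * of_int (X k) * T 1"
      using ab cop by (intro galois_conjugate cfam_Ints_Rats theta_cfam \<psi>) auto
    moreover have "of_int (-1) * \<theta> \<psi> k = \<theta> \<psi> 1" using k by (intro theta_scale \<psi> cop) simp
    \<comment> \<open>Conjugation by \<open>k\<close> turns \<open>a + b * T 1\<close> into
      \<open>a - b * T 1\<close>, which must be its negative.\<close>
    ultimately have "a = 0" using X ab(3) by simp
    hence b1: "\<theta> \<psi> 1 = b * T 1" using ab by simp
    \<comment> \<open>Squaring removes the irrationality: \<open>b ^ 2 * D\<close> is a rational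
      cyclotomic integer, hence an integer, and squarefreeness of \<open>D\<close> then makes
      \<open>b\<close> integral.\<close>
    hence "\<theta> \<psi> 1 ^ 2 = b ^ 2 * of_int D" by (simp only: power_mult_distrib T1_square)
    moreover have "(\<lambda>k. \<theta> \<psi> k ^ 2) \<in> cfam \<int> (urt n)" by (intro cfam_power theta_cfam \<psi>) auto
    ultimately have "b ^ 2 * of_int D \<in> \<int>"
      using cfam_rational_imp_int[OF n, of "\<lambda>k. \<theta> \<psi> k ^ 2" 1] ab(2) by simp
    hence "b \<in> \<int>" using rat_square_times_squarefree_int[OF sqf ab(2)] by blast
    thus "\<theta> \<psi> 1 \<in> int_mult_sqrt D" unfolding int_mult_sqrt_iff using b1 by (auto elim: Ints_cases)
  qed
qed

text \<open>From right to left, \<open>C2\<close> inherits invariance under \<open>H\<close> because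
  multiplications commute, and \<open>k\<close> also carries \<open>C2\<close> back to
  \<open>C1\<close> because \<open>k * k\<close> modulo \<open>n\<close> lies in
  \<open>H\<close>.\<close>

lemma swap_iff:
  assumes k: "k \<in> U - H"
  shows "(\<forall>h\<in>H. \<forall>g. f (gmul h g) = f g) \<and> (\<forall>g. f (gmul k g) = - f g) \<longleftrightarrow>
    union_of_classes H C1 \<and> C2 = gmul k ` C1"
proof -
  have cop: "coprime k n" using k U_coprime by blast
  have bij: "bij (gmul k :: 'a \<Rightarrow> 'a)" by (rule gmul_bij[OF e cop])
  show ?thesis
  proof
    assume L: "(\<forall>h\<in>H. \<forall>g. f (gmul h g) = f g) \<and> (\<forall>g. f (gmul k g) = - f g)"
    hence "union_of_classes H C1" using unions_iff by blast
    moreover have k12: "gmul k g \<in> C2 \<longleftrightarrow> g \<in> C1" for g using L f_neg by blast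
    have "C2 = gmul k ` C1"
    proof
      show "gmul k ` C1 \<subseteq> C2" using k12 by blast
      show "C2 \<subseteq> gmul k ` C1"
      proof
        fix y assume "y \<in> C2"
        moreover obtain g where "y = gmul k g" using bij by (metis bij_pointE)
        ultimately show "y \<in> gmul k ` C1" using k12 by blast
      qed
    qed
    ultimately show "union_of_classes H C1 \<and> C2 = gmul k ` C1" by blast
  next
    assume R: "union_of_classes H C1 \<and> C2 = gmul k ` C1"
    hence inv1: "\<And>h g. h \<in> H \<Longrightarrow> gmul h g \<in> C1 \<longleftrightarrow> g \<in> C1" by (simp add: union_of_classes_iff)
    have C2: "gmul k g \<in> C2 \<longleftrightarrow> g \<in> C1" for g
      using R bij by (metis bij_is_inj inj_image_mem_iff)
    have inv2: "gmul h g \<in> C2 \<longleftrightarrow> g \<in> C2" if h: "h \<in> H" for h g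
    proof -
      obtain g' where g': "g = gmul k g'" using bij by (metis bij_pointE)
      have "gmul h g = gmul k (gmul h g')" unfolding g' gmul_mult[symmetric] by (simp only: mult.commute)
      thus ?thesis using C2 inv1[OF h] g' by simp
    qed
    have "X k * X k = 1" using X_values[OF cop] by auto
    hence "(k * k) mod n \<in> H" using X_mod[of "k * k"] X_mult[OF cop cop] mod_in_U[of "k * k"] cop
      by (simp add: H_iff)
    hence kk: "gmul k (gmul k g) \<in> C1 \<longleftrightarrow> g \<in> C1" for g
      using inv1[of "(k * k) mod n" g] by (simp add: gmul_mod[OF e] gmul_mult)
    have C1: "gmul k g \<in> C1 \<longleftrightarrow> g \<in> C2" for g
    proof -
      obtain g' where g': "g = gmul k g'" using bij by (metis bij_pointE)
      show ?thesis unfolding g' kk C2 ..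
    qed
    show "(\<forall>h\<in>H. \<forall>g. f (gmul h g) = f g) \<and> (\<forall>g. f (gmul k g) = - f g)"
      unfolding f_cases f_neg using inv1 inv2 C1 C2 by blast
  qed
qed

text \<open>If \<open>D < 0\<close> then -1 lies in the same coset as \<open>k\<close>, so
  \<open>- k\<close> lies in \<open>H\<close>, and comparing \<open>f\<close> at
  \<open>gmul k (- g)\<close> in two ways gives the sign change. If \<open>D > 0\<close> then -1
  lies in \<open>H\<close> itself.\<close>

lemma swap_symmetry:
  assumes inv: "\<And>h g. h \<in> H \<Longrightarrow> f (gmul h g) = f g"
    and k: "k \<in> U - H" "\<And>g. f (gmul k g) = - f g"
  shows "D < 0 \<Longrightarrow> f (- g) = - f g" and "D > 0 \<Longrightarrow> f (- g) = f g"
proof -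
  have cop: "coprime k n" "coprime (n - 1) n" using k U_coprime n coprime_diff_one_left_nat by blast+
  have X: "X k = -1" using k X_values[OF cop(1)] by (auto simp: H_iff)
  show "f (- g) = - f g" if "D < 0"
  proof -
    have "(k * (n - 1)) mod n \<in> H"
      using X_mod[of "k * (n - 1)"] X_mult[OF cop] X X_minus_one(1)[OF that] mod_in_U[of "k * (n - 1)"] cop
      by (simp add: H_iff)
    from inv[OF this, of g] have "f (gmul k (- g)) = f g"
      by (simp only: gmul_mod[OF e] gmul_mult gmul_uminus_one[OF e n])
    thus ?thesis using k(2)[of "- g"] by simp
  qed
  show "f (- g) = f g" if "D > 0"
  proof -
    have "(n - 1) mod n \<in> H"
      using X_mod[OF cop(2)] X_minus_one(2)[OF that] mod_in_U[OF cop(2)] by (simp add: H_iff)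
    from inv[OF this, of g] show ?thesis
      by (simp only: gmul_mod[OF e] gmul_uminus_one[OF e n])
  qed
qed

end

theorem theorem8p1:
  fixes C1 C2 :: "'a::{ab_group_add,finite} set"
    and n1 :: nat and w0 w :: nat and S :: "nat set" and M :: "((complex, 'a) vec, 'a) vec"
  assumes n1_def: "n1 = group_exponent TYPE('a)"
    and S_sub: "S \<subseteq> {p. prime p \<and> odd p \<and> p dvd n1}"
    and w0_01: "w0 \<in> {0, 1}" and w_01: "w \<in> {0, 1}"
    and w0_m: "multiplicity (2::nat) n1 < 3 \<Longrightarrow> w0 = 0"
    and w_m: "multiplicity (2::nat) n1 < 2 \<Longrightarrow> w = 0"
    and disj: "C1 \<inter> C2 = {}"
    and zero_notin: "0 \<notin> C1 \<union> C2"
    and M_def: "M = A_set C1 - A_set C2"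
  shows
    "((\<forall>c. is_eigenvalue M c \<longrightarrow> c \<in> Q_sqrt (Delta w0 w S)) \<longleftrightarrow>
        union_of_classes (H_Delta n1 w0 w S) C1 \<and> union_of_classes (H_Delta n1 w0 w S) C2)
     \<and>
     ((\<forall>c. is_eigenvalue M c \<longrightarrow> c \<in> int_mult_sqrt (Delta w0 w S)) \<longleftrightarrow>
        (Delta w0 w S = 1 \<and> union_of_classes (H_Delta n1 0 0 {}) C1
                          \<and> union_of_classes (H_Delta n1 0 0 {}) C2)
        \<or> (Delta w0 w S \<noteq> 1 \<and> union_of_classes (H_Delta n1 w0 w S) C1
           \<and> (\<exists>k \<in> units_mod n1 - H_Delta n1 w0 w S. C2 = gmul k ` C1)))
     \<and>
     ((Delta w0 w S \<noteq> 1 \<and> union_of_classes (H_Delta n1 w0 w S) C1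
        \<and> (\<exists>k \<in> units_mod n1 - H_Delta n1 w0 w S. C2 = gmul k ` C1)) \<longrightarrow>
       (Delta w0 w S < 0 \<longrightarrow> C2 = uminus ` C1 \<and> C1 \<inter> uminus ` C1 = {}
          \<and> M = A_set C1 - transpose (A_set C1))
       \<and> (Delta w0 w S > 0 \<longrightarrow> C1 = uminus ` C1 \<and> C2 = uminus ` C2
          \<and> transpose M = M))"
proof -
  have n: "n1 > 0" and e: "\<And>g::'a. gmul n1 g = 0"
    unfolding n1_def by (rule group_exponent_props)+
  \<comment> \<open>The bounds on the power of 2 become divisibilities, which place the fourth and
    eighth roots of unity among the powers of \<open>urt n1\<close>.\<close>
  have w4: "w = 0 \<or> 4 dvd n1"
    using w_m multiplicity_dvd'[of 2 2 n1] by (cases "multiplicity 2 n1 < 2") auto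
  have w8: "w0 = 0 \<or> 8 dvd n1"
    using w0_m multiplicity_dvd'[of 3 2 n1] by (cases "multiplicity 2 n1 < 3") auto
  obtain T where T: "T \<in> cfam \<int> (urt n1)" "T 1 ^ 2 = of_int (Delta w0 w S)"
    "\<And>k. coprime k n1 \<Longrightarrow> T k = of_int (qchar w0 w S k) * T 1"
    by (rule sqrt_Delta_cfam[OF n S_sub w4 w8]) (rule that, blast+)
  interpret quadratic_cayley n1 w0 w S T C1 C2
  proof
    show "squarefree (Delta w0 w S)" using S_sub w0_01 by (intro squarefree_Delta) auto
    show "qchar w0 w S k \<in> {1, -1}" if "coprime k n1" for k
      using that by (rule qchar_values[OF S_sub w4 w8])
    show "T k = of_int (qchar w0 w S k) * T 1" if "coprime k n1" for k using that by (rule T(3))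
    show "gmul n1 g = 0" for g :: 'a by (fact e)
  qed (fact n T(1) T(2) disj)+
  have eig: "(\<forall>c. is_eigenvalue M c \<longrightarrow> c \<in> A) \<longleftrightarrow> (\<forall>\<psi>. is_char \<psi> \<longrightarrow> \<theta> \<psi> 1 \<in> A)" for A
    unfolding M_def eigenvalues_A_diff theta_1 by blast
  \<comment> \<open>The relation for \<Delta> = 1 uses all units, and \<open>D_eq_1_imp_H\<close>
    identifies \<open>H\<close> with them in that case.\<close>
  have H1: "H_Delta n1 0 0 {} = units_mod n1" by (simp add: H_Delta_def)
  have swap: "(\<forall>k\<in>H. \<forall>g. f (gmul k g) = f g) \<and> (\<exists>k\<in>U - H. \<forall>g. f (gmul k g) = - f g) \<longleftrightarrow>
    union_of_classes H C1 \<and> (\<exists>k\<in>U - H. C2 = gmul k ` C1)"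
    using swap_iff by blast
  have M_nth: "M $ u $ v = of_int (f (v - u))" for u v
    by (simp add: M_def A_set_nth sgn_ind_def of_bool_def)
  have part1: "(\<forall>c. is_eigenvalue M c \<longrightarrow> c \<in> Q_sqrt D) \<longleftrightarrow> union_of_classes H C1 \<and> union_of_classes H C2"
    unfolding eig quadratic_iff unions_iff ..
  have part2: "(\<forall>c. is_eigenvalue M c \<longrightarrow> c \<in> int_mult_sqrt D) \<longleftrightarrow>
        (D = 1 \<and> union_of_classes (H_Delta n1 0 0 {}) C1 \<and> union_of_classes (H_Delta n1 0 0 {}) C2)
        \<or> (D \<noteq> 1 \<and> union_of_classes H C1 \<and> (\<exists>k\<in>U - H. C2 = gmul k ` C1))"
  proof (cases "D = 1")
    case True
    thus ?thesis unfolding eig integral_iff_D_eq_1[OF True] unions_iff[symmetric]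
      using D_eq_1_imp_H[OF True] H1 by simp
  next
    case False
    thus ?thesis unfolding eig integral_iff_D_neq_1[OF False] swap by blast
  qed
  have part3: "(D < 0 \<longrightarrow> C2 = uminus ` C1 \<and> C1 \<inter> uminus ` C1 = {} \<and> M = A_set C1 - transpose (A_set C1))
       \<and> (D > 0 \<longrightarrow> C1 = uminus ` C1 \<and> C2 = uminus ` C2 \<and> transpose M = M)"
    if hyp: "union_of_classes H C1 \<and> (\<exists>k\<in>U - H. C2 = gmul k ` C1)"
  proof -
    have im: "uminus ` A = {g. - g \<in> A}" for A :: "'a set"
      by (rule Set.set_eqI) (metis image_iff mem_Collect_eq minus_minus)
    obtain k where k: "k \<in> U - H" "\<And>g. f (gmul k g) = - f g"
      using hyp unfolding swap[symmetric] by blast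
    have inv: "f (gmul h g) = f g" if "h \<in> H" for h g
      using hyp that unfolding swap[symmetric] by blast
    show ?thesis
    proof (intro conjI impI)
      assume D: "D < 0"
      have neg: "- g \<in> C1 \<longleftrightarrow> g \<in> C2" for g using swap_symmetry(1)[OF inv k D] f_neg by blast
      show C2: "C2 = uminus ` C1" unfolding im neg by simp
      \<comment> \<open>As \<open>C2\<close> is the negative of \<open>C1\<close>, disjointness of
        the two sets is exactly the condition for an oriented Cayley graph.\<close>
      show "C1 \<inter> uminus ` C1 = {}" using disj C2 by simp
      show "M = A_set C1 - transpose (A_set C1)"
      proof -
        have "v - u \<in> C2 \<longleftrightarrow> u - v \<in> C1" for u v using neg[of "v - u"] by simp
        thus ?thesis by (simp add: vec_eq_iff M_def A_set_nth transpose_def)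
      qed
    next
      assume D: "D > 0"
      have sym: "f (- g) = f g" for g using swap_symmetry(2)[OF inv k D] .
      show "C1 = uminus ` C1" "C2 = uminus ` C2" unfolding im using sym by (auto simp: f_cases)
      have "f (u - v) = f (v - u)" for u v using sym[of "v - u"] by simp
      thus "transpose M = M" by (simp add: vec_eq_iff transpose_def M_nth)
    qed
  qed
  show ?thesis using part1 part2 part3 by blast
qed

end
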